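(* Let $n\ge 2$ be an integer and consider the $n$-ary tree. For every $k\ge 2$ and every $\mathbf p=(\mathbf p_0,\dots,\mathbf p_k)\in\mathscr P_k$ such that $\mathbf p_1=\mathbf p_2>\mathbf p_3\ge\dots\ge\mathbf p_k$ and $\mathbf p_1<\frac12$, the sequence $\mathbf p(m)$ converges, as $m\to\infty$, to $\left(\alpha_n,\frac{1-\alpha_n}{2},\frac{1-\alpha_n}{2},0_{k-2}\right)$, where $\alpha_n$ is the unique fixed point in $(0,1)$ of the function $$f_n:t\in[0,1]\longmapsto\sum_{j,\;0\le 2j\le n}\binom{n}{2j}\binom{2j}{j}\left(\frac{1-t}{2}\right)^{2j}t^{n-2j}\in[0,1].$$ Moreover, the convergence of $\mathbf p(m)$ to $\left(\alpha_n,\frac{1-\alpha_n}{2},\frac{1-\alpha_n}{2},0_{k-2}\right)$ as $m\to\infty$ remains true when $\mathbf p_1=\mathbf p_2=\frac12$ and $n$ is even, whereas $\mathbf p(m)=\left(0,\frac12,\frac12,0_{k-2}\right)$ for every $m\ge 0$ when $\mathbf p_1=\mathbf p_2=\frac12$ and $n$ is odd.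
   Context: $\mathscr P_k:=\{\mathbf p=(\mathbf p_0,\dots,\mathbf p_k)\in(\mathbb R_+)^{k+1}:\sum_{i=0}^k\mathbf p_i=1,\ \mathbf p_0<1\}$. $0_{r}$ denotes $r$ zero coordinates (for $k=2$ the condition on $\mathbf p_3,\dots,\mathbf p_k$ is void). Opinion model on the $n$-ary tree cut at height $m$ (every node of generation $<m$ has exactly $n$ children): independently, each leaf (node of generation $m$) has opinion $i\in\{1,\dots,k\}$ with probability $\mathbf p_i$ and is undecided with probability $\mathbf p_0$. Opinions propagate from children to parent: undecided children have no influence, except that if all children are undecided then the parent is undecided; if one opinion is held by strictly more children than every other opinion (relative majority), the parent takes this opinion; if several opinions are tied for the largest number of children, the parent is undecided. $\mathbf p(m)=(\mathbf p_0(m),\dots,\mathbf p_k(m))$ is the law of the state of the root: $\mathbf p_i(m)=\mathbb P(\text{root thinks } i)$ for $1\le i\le k$, and $\mathbf p_0(m)=\mathbb P(\text{root undecided})$. Equivalently, $\mathbf p(0)=\mathbf p$ and $\mathbf p(m)=H(\mathbf p(m-1))$ where, for $1\le i\le k$, $$H_i(\mathbf p)=\sum_{m_0=0}^{n-1}\binom{n}{m_0}\mathbf p_0^{m_0}\sum_{(m_1,\dots,m_k)\in S^i_{n-m_0}}\binom{n-m_0}{m_1,\dots,m_k}\prod_{j=1}^k\mathbf p_j^{m_j},\qquad H_0(\mathbf p)=1-\sum_{j=1}^kH_j(\mathbf p),$$ with $S^i_r=\{(m_1,\dots,m_k)\in\mathbb N^k:\ m_j<m_i\ \forall j\ne i,\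 \sum_{j=1}^km_j=r\}$ and $\binom{r}{m_1,\dots,m_k}$ the multinomial coefficient. *)

theory Defs
  imports "HOL-Probability.Probability" "HOL-Probability.Product_PMF"
begin

(* States are natural numbers: 0 is "undecided", 1, ..., k are the opinions. A vector
   (p_0, ..., p_k) is a function on nat of which only the values at indices <= k matter. *)

definition opinion_simplex :: "nat \<Rightarrow> (nat \<Rightarrow> real) set" where
  "opinion_simplex k = {p. (\<forall>i\<le>k. 0 \<le> p i) \<and> (\<Sum>i\<le>k. p i) = 1 \<and> p 0 < 1}"

definition leaf_pmf :: "nat \<Rightarrow> (nat \<Rightarrow> real) \<Rightarrow> nat pmf" where
  "leaf_pmf k p = embed_pmf (\<lambda>i. if i \<le> k then p i else 0)"

lemma pmf_leaf_pmf:
  assumes "p \<in> opinion_simplex k"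
  shows "pmf (leaf_pmf k p) i = (if i \<le> k then p i else 0)"
proof -
  let ?g = "\<lambda>i. if i \<le> k then p i else 0"
  have nn: "\<And>i. 0 \<le> ?g i"
    using assms by (auto simp: opinion_simplex_def)
  have "(\<integral>\<^sup>+i. ennreal (?g i) \<partial>count_space UNIV)
      = (\<integral>\<^sup>+i. ennreal (?g i) * indicator {..k} i \<partial>count_space UNIV)"
    by (intro nn_integral_cong) (auto simp: indicator_def)
  also have "\<dots> = (\<Sum>i\<le>k. ennreal (?g i))"
    by (subst nn_integral_count_space_indicator [symmetric])
      (auto simp: nn_integral_count_space_finite)
  also have "\<dots> = ennreal (\<Sum>i\<le>k. ?g i)"
    by (intro sum_ennreal nn)
  also have "\<dots> = 1"
    using assms by (simp add: opinion_simplex_def)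
  finally show ?thesis
    unfolding leaf_pmf_def by (rule pmf_embed_pmf [OF nn])
qed

definition votes :: "nat \<Rightarrow> (nat \<Rightarrow> nat) \<Rightarrow> nat \<Rightarrow> nat" where
  "votes n c i = card {x. x < n \<and> c x = i}"

definition wins :: "nat \<Rightarrow> nat \<Rightarrow> (nat \<Rightarrow> nat) \<Rightarrow> nat \<Rightarrow> bool" where
  "wins n k c i \<longleftrightarrow> i \<in> {1..k} \<and> (\<forall>j\<in>{1..k} - {i}. votes n c j < votes n c i)"

definition parent_state :: "nat \<Rightarrow> nat \<Rightarrow> (nat \<Rightarrow> nat) \<Rightarrow> nat" where
  "parent_state n k c =
     (if \<forall>x<n. c x = 0 then 0
      else if \<exists>i. wins n k c i then (THE i. wins n k c i)
      else 0)"

(* Nodes of the n-ary tree are words over {0, ..., n - 1}; the root is [] and the children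
   of v are v @ [x] for x < n. *)

definition leaves :: "nat \<Rightarrow> nat \<Rightarrow> nat list set" where
  "leaves n m = {v. length v = m \<and> set v \<subseteq> {..<n}}"

(* State of the node v lying h generations above the leaves, when w gives the leaf states. *)

primrec node_state :: "nat \<Rightarrow> nat \<Rightarrow> (nat list \<Rightarrow> nat) \<Rightarrow> nat \<Rightarrow> nat list \<Rightarrow> nat" where
  "node_state n k w 0 v = w v"
| "node_state n k w (Suc h) v = parent_state n k (\<lambda>x. node_state n k w h (v @ [x]))"

definition root_pmf :: "nat \<Rightarrow> nat \<Rightarrow> (nat \<Rightarrow> real) \<Rightarrow> nat \<Rightarrow> nat pmf" where
  "root_pmf n k p m =
     map_pmf (\<lambda>w. node_state n k w m []) (Pi_pmf (leaves n m) 0 (\<lambda>_. leaf_pmf k p))"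

(* The i-th coordinate of p(m). *)

definition root_law :: "nat \<Rightarrow> nat \<Rightarrow> (nat \<Rightarrow> real) \<Rightarrow> nat \<Rightarrow> nat \<Rightarrow> real" where
  "root_law n k p m i = pmf (root_pmf n k p m) i"

definition tie_fun :: "nat \<Rightarrow> real \<Rightarrow> real" where
  "tie_fun n t =
     (\<Sum>j | 2 * j \<le> n. real (n choose (2 * j)) * real ((2 * j) choose j)
        * ((1 - t) / 2) ^ (2 * j) * t ^ (n - 2 * j))"

definition tie_fixpoint :: "nat \<Rightarrow> real" where
  "tie_fixpoint n = (THE t. t \<in> {0<..<1} \<and> tie_fun n t = t)"

(* The vector (a, (1 - a)/2, (1 - a)/2, 0, ..., 0). *)

definition two_opinion_vec :: "real \<Rightarrow> nat \<Rightarrow> real" where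
  "two_opinion_vec a i = (if i = 0 then a else if i = 1 \<or> i = 2 then (1 - a) / 2 else 0)"

end

theory Submission imports Defs begin

text \<open>
  The ratio of a minor opinion to the two leaders decreases geometrically: exchanging i and 1 in a
  configuration won by i multiplies its probability by at least p_1 / p_i, and the unanimous
  configurations give a uniform gain, because the probability of a decided root stays bounded below.
  So p_0(m + 1) - f(p_0(m)) tends to 0, where f is the tie function, and it remains to see that f
  strictly decreases the distance to its fixed point on a range that the orbit finally enters.

  Here f is the average of (t + (1 - t) cos x)^n over equidistant angles x, which makes the signs of
  its derivatives visible: f has an even-power second (n even) or third (n odd) derivative, whence
  uniqueness by Rolle's theorem. For odd n it is increasing. For even n it may decrease at the fixed
  point, but it is at least f(0) / 2 everywhere and its slope exceeds -1 beyond that value.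
\<close>

section \<open>The tie function as an average of powers of cosines\<close>

text \<open>\<open>tie_fun n t\<close> is the probability that two equally strong opinions tie among
  n children, each undecided with probability t. So it is the coefficient of z^0 in (t + (1 - t)(z +
  1/z)/2)^n, and averaging over enough roots of unity z extracts it; this is the origin of the
  cosines. The obstacle is that the limit is not the only fixed point: 1 is always fixed, and so is
  0 for odd n. The orbit must be confined to a compact interval that avoids them. Staying away from
  1 is the lower bound on the decided mass, which also drives the decay of the minor opinions.
  Staying away from 0 for odd n rests on the slope n C(n-1, (n-1)/2) / 2^(n-1) > 1 at 0, and on p_1
  < 1/2 for leaving 0 at all. On such an interval a strict contraction tolerates any error that
  tends to 0, so no rate has to be tracked.\<close>

definition tie_poly :: "nat \<Rightarrow> real \<Rightarrow> real \<Rightarrow> real" where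
  "tie_poly n a b =
     (\<Sum>j | 2 * j \<le> n. real (n choose (2 * j)) * real ((2 * j) choose j) * b ^ (2 * j) * a ^ (n - 2 * j))"

text \<open>\<open>tie_poly\<close> keeps both probabilities free because minor opinions leave a + 2
  b below 1 along the orbit; the tie function is the case a + 2 b = 1.\<close>

lemma tie_fun_eq_tie_poly: "tie_fun n t = tie_poly n t ((1 - t) / 2)"
  by (simp add: tie_fun_def tie_poly_def)

lemma finite_double_le: "finite {j::nat. 2 * j \<le> n}"
  by (rule finite_subset[of _ "{..n}"]) auto

text \<open>A geometric sum whose ratio is an L-th root of unity; for d different from 0 the ratio
  is not 1, because 0 < |d| < L excludes the multiples of L.\<close>

lemma sum_cis_multiples:
  fixes d :: int and L :: nat
  assumes "\<bar>d\<bar> < int L"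
  shows "(\<Sum>l<L. cis (2 * pi * of_int d / L) ^ l) = (if d = 0 then of_nat L else 0)"
proof (cases "d = 0")
  case False
  let ?z = "cis (2 * pi * of_int d / L)"
  have L: "L > 0" using assms by auto
  have "?z ^ L = cis (2 * pi * of_int d)"
    unfolding Complex.DeMoivre using L by simp
  also have "\<dots> = 1"
    by (metis Ints_of_int cis_multiple_2pi)
  finally have zL: "?z ^ L = 1" .
  have "?z \<noteq> 1"
  proof
    assume "?z = 1"
    then have "cos (2 * pi * of_int d / L) = 1"
      by (metis cis.sel(1) one_complex.sel(1))
    then obtain m :: int where "2 * pi * of_int d / L = of_int m * 2 * pi"
      using cos_one_2pi_int by auto
    then have "real_of_int d = of_int m * real L"
      using L by (simp add: field_simps)
    then have d: "d = m * int L"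
      by (metis of_int_eq_iff of_int_mult of_int_of_nat_eq)
    with False have "\<bar>m\<bar> \<ge> 1" by auto
    then have "\<bar>d\<bar> \<ge> int L"
      unfolding d abs_mult by (metis abs_of_nat mult_1 mult_right_mono of_nat_0_le_iff)
    with assms show False by simp
  qed
  then show ?thesis
    using zL False by (simp add: geometric_sum)
qed simp

text \<open>Expanding (z + 1/z)^m on the unit circle gives powers z^(2j - m), and the average kills
  all but 2j = m. The condition m < L keeps nonzero exponents from being multiples of L.\<close>

lemma sum_cos_power:
  fixes L m :: nat
  assumes "m < L"
  shows "(\<Sum>l<L. (2 * cos (2 * pi * l / L)) ^ m) = (if even m then real (L * (m choose (m div 2))) else 0)"
proof -
  have L: "L > 0" using assms by auto
  have pow: "complex_of_real ((2 * cos (2 * pi * l / L)) ^ m)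
      = (\<Sum>j\<le>m. of_nat (m choose j) * cis (2 * pi * of_int (2 * int j - int m) / L) ^ l)" for l :: nat
  proof -
    let ?x = "2 * pi * l / L"
    have "complex_of_real (2 * cos ?x) = cis ?x + cis (- ?x)"
      by (simp add: complex_eq_iff)
    then have "complex_of_real ((2 * cos ?x) ^ m) = (cis ?x + cis (- ?x)) ^ m"
      by (metis of_real_power)
    also have "\<dots> = (\<Sum>j\<le>m. of_nat (m choose j) * cis ?x ^ j * cis (- ?x) ^ (m - j))"
      by (rule binomial_ring)
    also have "\<dots> = (\<Sum>j\<le>m. of_nat (m choose j) * cis (2 * pi * of_int (2 * int j - int m) / L) ^ l)"
    proof (rule sum.cong[OF refl])
      fix j assume "j \<in> {..m}"
      then have jm: "j \<le> m" by simp
      have "cis ?x ^ j * cis (- ?x) ^ (m - j) = cis (j * ?x - (m - j) * ?x)"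
        unfolding Complex.DeMoivre cis_mult by (simp only: mult_minus_right diff_conv_add_uminus)
      also have "j * ?x - (m - j) * ?x = l * (2 * pi * of_int (2 * int j - int m) / L)"
        using jm by (simp add: of_nat_diff algebra_simps diff_divide_distrib add_divide_distrib)
      finally show "of_nat (m choose j) * cis ?x ^ j * cis (- ?x) ^ (m - j)
          = of_nat (m choose j) * cis (2 * pi * of_int (2 * int j - int m) / L) ^ l"
        unfolding Complex.DeMoivre mult.assoc by (simp only:)
    qed
    finally show ?thesis .
  qed
  have "complex_of_real (\<Sum>l<L. (2 * cos (2 * pi * l / L)) ^ m)
      = (\<Sum>l<L. \<Sum>j\<le>m. of_nat (m choose j) * cis (2 * pi * of_int (2 * int j - int m) / L) ^ l)"
    using pow by simp
  also have "\<dots> = (\<Sum>j\<le>m. of_nat (m choose j) * (\<Sum>l<L. cis (2 * pi * of_int (2 * int j - int m) / L) ^ l))"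
    by (subst sum.swap) (simp add: sum_distrib_left)
  also have "\<dots> = (\<Sum>j\<le>m. of_nat (m choose j) * (if 2 * int j - int m = 0 then of_nat L else 0))"
    using assms by (intro sum.cong refl arg_cong2[of _ _ _ _ "(*)"] sum_cis_multiples) auto
  also have "\<dots> = (\<Sum>j\<le>m. if 2 * j = m then of_nat (L * (m choose j)) else 0)"
    by (intro sum.cong) auto
  also have "\<dots> = (if even m then of_nat (L * (m choose (m div 2))) else 0)"
  proof (cases "even m")
    case True
    then have "(2 * j = m) = (j = m div 2)" for j by auto
    with True show ?thesis by simp
  next
    case False
    then have "2 * j \<noteq> m" for j by auto
    with False show ?thesis by simp
  qed
  also have "\<dots> = complex_of_real (if even m then real (L * (m choose (m div 2))) else 0)"
    by simp
  finally show ?thesis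
    unfolding of_real_eq_iff .
qed

lemma tie_poly_cos_average:
  fixes n L :: nat
  assumes "n < L"
  shows "tie_poly n a b = (\<Sum>l<L. (a + 2 * b * cos (2 * pi * real l / real L)) ^ n) / real L"
proof -
  have L: "real L > 0" using assms by simp
  have "(\<Sum>l<L. (a + 2 * b * cos (2 * pi * l / L)) ^ n)
      = (\<Sum>l<L. \<Sum>N\<le>n. real (n choose N) * b ^ N * a ^ (n - N) * (2 * cos (2 * pi * l / L)) ^ N)"
  proof (rule sum.cong[OF refl])
    fix l
    have "(a + 2 * b * cos (2 * pi * l / L)) ^ n = (b * (2 * cos (2 * pi * l / L)) + a) ^ n"
      by (simp add: algebra_simps)
    also have "\<dots> = (\<Sum>N\<le>n. real (n choose N) * (b * (2 * cos (2 * pi * l / L))) ^ N * a ^ (n - N))"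
      by (rule binomial_ring)
    finally show "(a + 2 * b * cos (2 * pi * l / L)) ^ n
        = (\<Sum>N\<le>n. real (n choose N) * b ^ N * a ^ (n - N) * (2 * cos (2 * pi * l / L)) ^ N)"
      by (simp add: power_mult_distrib mult_ac)
  qed
  also have "\<dots> = (\<Sum>N\<le>n. real (n choose N) * b ^ N * a ^ (n - N) * (\<Sum>l<L. (2 * cos (2 * pi * l / L)) ^ N))"
    by (subst sum.swap) (simp add: sum_distrib_left)
  also have "\<dots> = (\<Sum>N\<le>n. real (n choose N) * b ^ N * a ^ (n - N)
      * (if even N then real (L * (N choose (N div 2))) else 0))"
    using assms by (intro sum.cong refl, subst sum_cos_power) auto
  also have "\<dots> = (\<Sum>N\<in>(\<lambda>j. 2 * j) ` {j. 2 * j \<le> n}. real (n choose N) * b ^ N * a ^ (n - N)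
      * (if even N then real (L * (N choose (N div 2))) else 0))"
    by (rule sum.mono_neutral_right) (auto elim!: evenE)
  also have "\<dots> = L * tie_poly n a b"
    by (subst sum.reindex) (auto simp: inj_on_def tie_poly_def sum_distrib_left mult_ac intro!: sum.cong)
  finally show ?thesis using L by simp
qed

definition tie_node :: "nat \<Rightarrow> nat \<Rightarrow> real" where
  "tie_node n l = cos (2 * pi * real l / real (4 * n + 4))"

text \<open>The number of nodes exceeds n, so that the average reproduces the tie function exactly, and is a
  multiple of 4, so that the nodes come in antipodal pairs and 0 is one of them.\<close>

definition tie_moment :: "nat \<Rightarrow> nat \<Rightarrow> nat \<Rightarrow> real \<Rightarrow> real" where
  "tie_moment n d m t =
     (\<Sum>l<4 * n + 4. (t + (1 - t) * tie_node n l) ^ m * (1 - tie_node n l) ^ d) / (4 * n + 4)"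

lemma tie_fun_eq_moment: "tie_fun n = tie_moment n 0 n"
proof
  fix t show "tie_fun n t = tie_moment n 0 n t"
    unfolding tie_fun_eq_tie_poly tie_moment_def
    by (subst tie_poly_cos_average[of n "4 * n + 4"]) (simp_all add: tie_node_def diff_divide_distrib algebra_simps)
qed

text \<open>Differentiating the base t + (1 - t) c brings out 1 - c, so d counts derivatives while n
  only fixes the nodes. As 1 - c is nonnegative, an even m makes the sign visible.\<close>

lemma tie_moment_deriv:
  "(tie_moment n d m has_real_derivative m * tie_moment n (Suc d) (m - 1) t) (at t within S)"
proof -
  have "((\<lambda>t. (\<Sum>l<4 * n + 4. (t + (1 - t) * tie_node n l) ^ m * (1 - tie_node n l) ^ d) / (4 * n + 4))
     has_real_derivative (\<Sum>l<4 * n + 4. m * ((t + (1 - t) * tie_node n l) ^ (m - 1) * (1 - tie_node n l))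
        * (1 - tie_node n l) ^ d) / (4 * n + 4)) (at t within S)"
    by (rule derivative_eq_intros DERIV_sum refl | simp)+
       (simp add: algebra_simps)
  moreover have "(\<Sum>l<4 * n + 4. m * ((t + (1 - t) * tie_node n l) ^ (m - 1) * (1 - tie_node n l))
        * (1 - tie_node n l) ^ d) / (4 * n + 4) = m * tie_moment n (Suc d) (m - 1) t"
    unfolding tie_moment_def by (simp add: sum_distrib_left mult_ac)
  moreover have "tie_moment n d m
     = (\<lambda>t. (\<Sum>l<4 * n + 4. (t + (1 - t) * tie_node n l) ^ m * (1 - tie_node n l) ^ d) / (4 * n + 4))"
    by (rule ext) (simp add: tie_moment_def)
  ultimately show ?thesis by simp
qed

lemma tie_node_bounds: "-1 \<le> tie_node n l" "tie_node n l \<le> 1"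
  by (auto simp: tie_node_def)

lemma tie_node_zero: "tie_node n (n + 1) = 0"
proof -
  have "2 * pi * real (n + 1) / real (4 * n + 4) = pi / 2"
    by (simp add: field_simps)
  then show ?thesis unfolding tie_node_def by (simp only: cos_pi_half)
qed

lemma tie_node_antipodal: "tie_node n (l + (2 * n + 2)) = - tie_node n l"
proof -
  have "2 * pi * real (l + (2 * n + 2)) / real (4 * n + 4) = 2 * pi * real l / real (4 * n + 4) + pi"
    by (simp add: field_simps)
  then show ?thesis unfolding tie_node_def by (simp only: cos_periodic_pi)
qed

lemma tie_moment_nonneg: "even m \<Longrightarrow> tie_moment n d m t \<ge> 0"
  unfolding tie_moment_def using tie_node_bounds[of n]
  by (intro divide_nonneg_pos sum_nonneg mult_nonneg_nonneg) (auto simp: zero_le_even_power)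

text \<open>The node with cosine 0 contributes t^m, whatever d is.\<close>

lemma tie_moment_pos:
  assumes "even m" "t > 0"
  shows "tie_moment n d m t > 0"
proof -
  have "(\<Sum>l<4 * n + 4. (t + (1 - t) * tie_node n l) ^ m * (1 - tie_node n l) ^ d) > 0"
  proof (rule sum_pos2[where i = "n + 1"])
    show "0 \<le> (t + (1 - t) * tie_node n l) ^ m * (1 - tie_node n l) ^ d" for l
      using assms tie_node_bounds[where l=l and n=n] by (auto simp: zero_le_even_power)
  qed (use assms in \<open>auto simp: tie_node_zero[simplified]\<close>)
  then show ?thesis unfolding tie_moment_def by (intro divide_pos_pos) auto
qed

section \<open>Values and elementary bounds of the tie function\<close>

lemma tie_fun_deriv:
  "(tie_fun n has_real_derivative n * tie_moment n 1 (n - 1) t) (at t within S)"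
  using tie_moment_deriv[of n 0 n t S] by (simp add: tie_fun_eq_moment)

lemma continuous_on_tie_fun: "continuous_on S (tie_fun n)"
  by (rule DERIV_continuous_on) (rule tie_fun_deriv)

lemma tie_fun_isCont: "isCont (tie_fun n) t"
  using tie_fun_deriv DERIV_isCont by blast

lemma choose_half_le: "real ((2 * j) choose j) \<le> 4 ^ j"
proof -
  have "(2 * j) choose j \<le> 2 ^ (2 * j)" by (rule binomial_le_pow2)
  then have "real ((2 * j) choose j) \<le> real (2 ^ (2 * j))" by (simp only: of_nat_le_iff)
  then show ?thesis by (simp add: power_mult)
qed

lemma tie_fun_0: "even n \<Longrightarrow> tie_fun n 0 = (n choose (n div 2)) / 2 ^ n"
proof -
  assume n: "even n"
  have "tie_fun n 0 = (\<Sum>j\<in>{n div 2}. real (n choose (2 * j)) * real ((2 * j) choose j)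
        * ((1 - 0) / 2) ^ (2 * j) * 0 ^ (n - 2 * j))"
    unfolding tie_fun_def using n
    by (intro sum.mono_neutral_right) (auto simp: finite_double_le elim!: evenE)
  then show ?thesis using n by (simp add: power_divide)
qed

lemma tie_fun_0_odd: "odd n \<Longrightarrow> tie_fun n 0 = 0"
proof -
  assume n: "odd n"
  have "n - 2 * j > 0" if "2 * j \<le> n" for j using that n by (cases "2 * j = n") auto
  then show ?thesis unfolding tie_fun_def by (intro sum.neutral) auto
qed

lemma tie_fun_1: "tie_fun n 1 = 1"
  by (simp add: tie_fun_eq_moment tie_moment_def divide_simps)

lemma tie_fun_nonneg: "0 \<le> t \<Longrightarrow> t \<le> 1 \<Longrightarrow> 0 \<le> tie_fun n t"
  unfolding tie_fun_def by (intro sum_nonneg) auto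

text \<open>A tie needs an even number of decided children, so the event that exactly one has
  decided is lost: the bound is the expansion of ((1 - t) + t)^n without that term.\<close>

lemma tie_fun_le:
  assumes t: "0 \<le> t" "t \<le> 1" and n: "n \<ge> 1"
  shows "tie_fun n t \<le> 1 - n * (1 - t) * t ^ (n - 1)"
proof -
  let ?B = "\<lambda>N. real (n choose N) * (1 - t) ^ N * t ^ (n - N)"
  have "tie_fun n t \<le> (\<Sum>j | 2 * j \<le> n. ?B (2 * j))"
    unfolding tie_fun_def
  proof (rule sum_mono)
    fix j
    have "real ((2 * j) choose j) * ((1 - t) / 2) ^ (2 * j) \<le> 4 ^ j * ((1 - t) / 2) ^ (2 * j)"
      using choose_half_le by (intro mult_right_mono) auto
    also have "\<dots> = (1 - t) ^ (2 * j)"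
      by (simp add: power_mult power_divide)
    finally have "real (n choose (2 * j)) * (real ((2 * j) choose j) * ((1 - t) / 2) ^ (2 * j)) * t ^ (n - 2 * j)
        \<le> ?B (2 * j)"
      using t by (intro mult_right_mono mult_left_mono) auto
    then show "real (n choose (2 * j)) * real ((2 * j) choose j) * ((1 - t) / 2) ^ (2 * j) * t ^ (n - 2 * j)
        \<le> ?B (2 * j)"
      by (simp add: mult_ac)
  qed
  also have "\<dots> = (\<Sum>N\<in>(\<lambda>j. 2 * j) ` {j. 2 * j \<le> n}. ?B N)"
    by (subst sum.reindex) (auto simp: inj_on_def)
  also have "\<dots> \<le> (\<Sum>N\<in>{..n} - {1}. ?B N)"
    using t by (intro sum_mono2) auto
  also have "\<dots> = (\<Sum>N\<le>n. ?B N) - ?B 1"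
    using n by (subst sum_diff1) auto
  also have "(\<Sum>N\<le>n. ?B N) = 1"
    using binomial_ring[of "1 - t" t n] by simp
  finally show ?thesis by simp
qed

lemma tie_poly_ge_term:
  assumes "0 \<le> a" "0 \<le> b" "2 * j \<le> n"
  shows "real (n choose (2 * j)) * real ((2 * j) choose j) * b ^ (2 * j) * a ^ (n - 2 * j) \<le> tie_poly n a b"
  unfolding tie_poly_def
  by (rule member_le_sum[where f = "\<lambda>j. real (n choose (2 * j)) * real ((2 * j) choose j) * b ^ (2 * j) * a ^ (n - 2 * j)"])
     (use assms finite_double_le in auto)

text \<open>The quotient of the two sides is the slope of \<open>tie_fun n\<close> at 0, hence the
  growth factor of a small undecided mass. The central binomial bound gives 4^h <= 2h C(2h, h), and
  the extra C(2h, h) in n = 2h + 1 makes it strict.\<close>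

lemma odd_central_gt:
  assumes "odd n" "n \<ge> 2"
  shows "real n * real ((n - 1) choose ((n - 1) div 2)) > 2 ^ (n - 1)"
proof -
  from assms obtain h where h: "n = 2 * h + 1" by (elim oddE)
  with assms have "h > 0" by auto
  then have "(4::real) ^ h \<le> 2 * h * ((2 * h) choose h)"
    using central_binomial_lower_bound[of h] by (simp add: field_simps)
  also have "\<dots> < real (2 * h * ((2 * h) choose h)) + real ((2 * h) choose h)"
    using zero_less_binomial[of h "2 * h"] by simp
  also have "\<dots> = real n * real ((n - 1) choose ((n - 1) div 2))"
    by (simp add: h algebra_simps)
  finally show ?thesis
    by (simp add: h power_mult)
qed

section \<open>Fixed point and contraction\<close>

lemma tie_fun_le_1: "0 \<le> t \<Longrightarrow> t \<le> 1 \<Longrightarrow> n \<ge> 1 \<Longrightarrow> tie_fun n t \<le> 1"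
  using tie_fun_le[of t n] by (smt (verit) mult_nonneg_nonneg of_nat_0_le_iff zero_le_power)

lemma tie_fun_odd_ge:
  assumes n: "odd n" and t: "0 \<le> t" "t \<le> 1"
  shows "n * real ((n - 1) choose ((n - 1) div 2)) / 2 ^ (n - 1) * (1 - t) ^ (n - 1) * t \<le> tie_fun n t"
proof -
  from n obtain h where h: "n = 2 * h + 1" by (elim oddE)
  show ?thesis
    using tie_poly_ge_term[of t "(1 - t) / 2" h n] t
    by (simp add: h tie_fun_eq_tie_poly power_divide mult_ac)
qed

text \<open>For even n the value at 0 is positive; for odd n it is 0, but the slope there,
  \<open>K\<close> below, exceeds 1.\<close>

lemma tie_fun_gt_near_0:
  assumes n: "n \<ge> 2"
  shows "\<forall>\<^sub>F t in at_right 0. tie_fun n t > t"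
proof (cases "even n")
  case True
  have "((\<lambda>t. tie_fun n t - t) \<longlongrightarrow> tie_fun n 0 - 0) (at_right 0)"
    using tie_fun_isCont[of 0 n, unfolded isCont_def filterlim_at_split] by (intro tendsto_intros) blast
  moreover have "tie_fun n 0 - 0 > 0"
    using True by (simp add: tie_fun_0)
  ultimately have "\<forall>\<^sub>F t in at_right 0. 0 < tie_fun n t - t"
    by (rule order_tendstoD)
  then show ?thesis by eventually_elim simp
next
  case False
  define K where "K = n * real ((n - 1) choose ((n - 1) div 2)) / 2 ^ (n - 1)"
  have K: "K > 1" using odd_central_gt[OF False n] by (simp add: K_def)
  have "((\<lambda>t. K * (1 - t) ^ (n - 1)) \<longlongrightarrow> K * (1 - 0) ^ (n - 1)) (at_right 0)"
    by (intro tendsto_intros)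
  then have "\<forall>\<^sub>F t in at_right 0. 1 < K * (1 - t) ^ (n - 1)"
    using K by (intro order_tendstoD) auto
  moreover have "\<forall>\<^sub>F t::real in at_right 0. t > 0 \<and> t < 1"
    unfolding eventually_at_right[OF zero_less_one] by (auto intro!: exI[of _ 1])
  ultimately show ?thesis
  proof eventually_elim
    case (elim t)
    then have "t < K * (1 - t) ^ (n - 1) * t" by simp
    also have "\<dots> \<le> tie_fun n t"
      using tie_fun_odd_ge[OF False, of t] elim by (simp add: K_def)
    finally show ?case .
  qed
qed

lemma tie_fun_lt_near_1:
  assumes n: "n \<ge> 2"
  shows "\<forall>\<^sub>F t in at_left 1. tie_fun n t < t"
proof -
  have "((\<lambda>t::real. n * t ^ (n - 1)) \<longlongrightarrow> real n * 1 ^ (n - 1)) (at_left 1)"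
    by (intro tendsto_intros)
  then have "\<forall>\<^sub>F t::real in at_left 1. 1 < n * t ^ (n - 1)"
    using n by (intro order_tendstoD) auto
  moreover have "\<forall>\<^sub>F t::real in at_left 1. t > 0 \<and> t < 1"
    unfolding eventually_at_left[OF zero_less_one] by (auto intro!: exI[of _ 0])
  ultimately show ?thesis
  proof eventually_elim
    case (elim t)
    have "tie_fun n t \<le> 1 - (1 - t) * (n * t ^ (n - 1))"
      using tie_fun_le[of t n] elim n by (simp add: mult_ac)
    also have "\<dots> < 1 - (1 - t) * 1"
      using elim by (intro diff_strict_left_mono mult_strict_left_mono) auto
    finally show ?case by simp
  qed
qed

lemma tie_fun_fixpoint_between:
  assumes "a \<le> b" "(a \<le> tie_fun n a \<and> tie_fun n b \<le> b) \<or> (tie_fun n a \<le> a \<and> b \<le> tie_fun n b)"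
  shows "\<exists>t. a \<le> t \<and> t \<le> b \<and> tie_fun n t = t"
proof -
  have c: "continuous_on {a..b} (\<lambda>t. tie_fun n t - t)"
    by (intro continuous_intros continuous_on_tie_fun)
  from assms(2) show ?thesis
  proof
    assume "a \<le> tie_fun n a \<and> tie_fun n b \<le> b"
    then show ?thesis
      using IVT2'[of "\<lambda>t. tie_fun n t - t" b 0 a] c assms(1) by auto
  next
    assume "tie_fun n a \<le> a \<and> b \<le> tie_fun n b"
    then show ?thesis
      using IVT'[of "\<lambda>t. tie_fun n t - t" a 0 b] c assms(1) by auto
  qed
qed

lemma at_right_0_obtain:
  assumes "eventually P (at_right (0::real))" "0 < b"
  obtains s where "0 < s" "s < b" "P s"
proof -
  obtain d where "d > 0" "\<And>y. 0 < y \<Longrightarrow> y < d \<Longrightarrow> P y"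
    using assms(1) unfolding eventually_at_right[OF zero_less_one] by blast
  then show ?thesis using that[of "min b d / 2"] assms(2) by auto
qed

lemma at_left_1_obtain:
  assumes "eventually P (at_left (1::real))" "b < 1"
  obtains s where "b < s" "s < 1" "P s"
proof -
  obtain d where "d < 1" "\<And>y. d < y \<Longrightarrow> y < 1 \<Longrightarrow> P y"
    using assms(1) unfolding eventually_at_left[OF zero_less_one] by blast
  then show ?thesis using that[of "(1 + max b d) / 2"] assms(2) by auto
qed

lemma Rolle_zero:
  fixes g g' :: "real \<Rightarrow> real"
  assumes "a < b" "g a = g b" "\<And>x. (g has_real_derivative g' x) (at x)"
  obtains z where "a < z" "z < b" "g' z = 0"
proof -
  have "continuous_on {a..b} g"
    using assms(3) DERIV_isCont by (blast intro: continuous_at_imp_continuous_on)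
  then obtain z where "a < z" "z < b" "(g has_real_derivative 0) (at z)"
    using Rolle[OF assms(1,2)] assms(3) by (auto simp: real_differentiable_def)
  then show ?thesis using that assms(3) DERIV_unique by blast
qed

text \<open>Two interior fixed points, together with the fixed point 1 (and 0 when n is odd), would
  force a zero of the second (third) derivative, whose integrand is an even power.\<close>

lemma tie_fun_fixpoint_unique:
  assumes n: "n \<ge> 2" and st: "0 < s" "s < t" "t < 1" "tie_fun n s = s" "tie_fun n t = t"
  shows False
proof -
  define g0 where "g0 x = tie_fun n x - x" for x
  define g1 where "g1 x = n * tie_moment n 1 (n - 1) x - 1" for x
  define g2 where "g2 x = n * ((n - 1) * tie_moment n 2 (n - 2) x)" for x
  define g3 where "g3 x = n * ((n - 1) * ((n - 2) * tie_moment n 3 (n - 3) x))" for x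
  have d0: "(g0 has_real_derivative g1 x) (at x)" for x
    unfolding g0_def g1_def by (auto intro!: derivative_eq_intros tie_fun_deriv)
  have d1: "(g1 has_real_derivative g2 x) (at x)" for x
    unfolding g1_def g2_def using n
    by (auto intro!: derivative_eq_intros tie_moment_deriv simp: numeral_2_eq_2 of_nat_diff)
  have d2: "(g2 has_real_derivative g3 x) (at x)" for x
    unfolding g2_def g3_def using n
    by (auto intro!: derivative_eq_intros tie_moment_deriv simp: numeral_2_eq_2 numeral_3_eq_3 of_nat_diff)
  have z: "g0 s = g0 t" "g0 t = g0 1" using st by (auto simp: g0_def tie_fun_1)
  obtain u where u: "s < u" "u < t" "g1 u = 0"
    using Rolle_zero[OF st(2) z(1) d0] by metis
  obtain v where v: "t < v" "v < 1" "g1 v = 0"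
    using Rolle_zero[OF st(3) z(2) d0] by metis
  obtain w where w: "u < w" "w < v" "g2 w = 0"
    using Rolle_zero[of u v, OF _ _ d1] u v by (metis less_trans)
  show False
  proof (cases "even n")
    case True
    then have "tie_moment n 2 (n - 2) w > 0"
      using w u st by (intro tie_moment_pos) auto
    with w(3) n show False by (simp add: g2_def)
  next
    case False
    with n have n3: "n \<ge> 3" by (cases "n = 2") auto
    have "g0 0 = g0 s" using False st by (auto simp: g0_def tie_fun_0_odd)
    then obtain u' where u': "0 < u'" "u' < s" "g1 u' = 0"
      using Rolle_zero[OF st(1) _ d0] by metis
    have "u' < u" "g1 u' = g1 u" using u u' by auto
    then obtain w' where w': "u' < w'" "w' < u" "g2 w' = 0"
      using Rolle_zero[OF _ _ d1] by metis
    have "w' < w" "g2 w' = g2 w" using w w' by auto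
    then obtain y where y: "w' < y" "y < w" "g3 y = 0"
      using Rolle_zero[OF _ _ d2] by metis
    then have "tie_moment n 3 (n - 3) y > 0"
      using w' u' False n3 by (intro tie_moment_pos) auto
    with y(3) n3 show False by (simp add: g3_def)
  qed
qed

lemma tie_fixpoint_ex1:
  assumes n: "n \<ge> 2"
  shows "\<exists>!t. t \<in> {0<..<1} \<and> tie_fun n t = t"
proof -
  obtain a where a: "0 < a" "a < 1/2" "a < tie_fun n a"
    using at_right_0_obtain[OF tie_fun_gt_near_0[OF n], of "1/2"] by auto
  obtain b where b: "1/2 < b" "b < 1" "tie_fun n b < b"
    using at_left_1_obtain[OF tie_fun_lt_near_1[OF n], of "1/2"] by auto
  obtain t where t: "a \<le> t" "t \<le> b" "tie_fun n t = t"
    using tie_fun_fixpoint_between[of a b n] a b by auto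
  show ?thesis
  proof (rule ex1I[of _ t])
    show "t \<in> {0<..<1} \<and> tie_fun n t = t" using t a b by auto
    fix s assume "s \<in> {0<..<1} \<and> tie_fun n s = s"
    then show "s = t"
      using tie_fun_fixpoint_unique[OF n, of s t] tie_fun_fixpoint_unique[OF n, of t s] t a b
      by (cases s t rule: linorder_cases) auto
  qed
qed

lemma tie_fixpoint:
  assumes "n \<ge> 2"
  shows "0 < tie_fixpoint n" "tie_fixpoint n < 1" "tie_fun n (tie_fixpoint n) = tie_fixpoint n"
  using theI'[OF tie_fixpoint_ex1[OF assms]] unfolding tie_fixpoint_def[symmetric] by auto

lemma tie_fixpoint_eqI:
  "n \<ge> 2 \<Longrightarrow> 0 < t \<Longrightarrow> t < 1 \<Longrightarrow> tie_fun n t = t \<Longrightarrow> t = tie_fixpoint n"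
  using tie_fixpoint[of n] tie_fixpoint_ex1[of n] by auto

text \<open>Otherwise the graph, which lies above the diagonal near 0, would meet it at or before t,
  at a second interior fixed point.\<close>

lemma tie_fun_gt:
  assumes n: "n \<ge> 2" and t: "0 < t" "t < tie_fixpoint n"
  shows "t < tie_fun n t"
proof (rule ccontr)
  assume "\<not> t < tie_fun n t"
  moreover obtain a where a: "0 < a" "a < t" "a < tie_fun n a"
    using at_right_0_obtain[OF tie_fun_gt_near_0[OF n] t(1)] by auto
  ultimately obtain s where "a \<le> s" "s \<le> t" "tie_fun n s = s"
    using tie_fun_fixpoint_between[of a t n] by auto
  then show False
    using tie_fixpoint_eqI[OF n, of s] tie_fixpoint[OF n] a t by auto
qed

lemma tie_fun_lt:
  assumes n: "n \<ge> 2" and t: "tie_fixpoint n < t" "t < 1"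
  shows "tie_fun n t < t"
proof (rule ccontr)
  assume "\<not> tie_fun n t < t"
  moreover obtain b where b: "t < b" "b < 1" "tie_fun n b < b"
    using at_left_1_obtain[OF tie_fun_lt_near_1[OF n] t(2)] by auto
  ultimately obtain s where "t \<le> s" "s \<le> b" "tie_fun n s = s"
    using tie_fun_fixpoint_between[of t b n] by auto
  then show False
    using tie_fixpoint_eqI[OF n, of s] tie_fixpoint[OF n] b t by auto
qed

text \<open>The exponent n - 1 is even, so every summand of the derivative is nonnegative.\<close>

lemma tie_fun_mono_odd:
  assumes "odd n" "s \<le> t"
  shows "tie_fun n s \<le> tie_fun n t"
  by (rule DERIV_nonneg_imp_nondecreasing[OF assms(2)])
     (use assms(1) tie_fun_deriv tie_moment_nonneg[of "n - 1" n 1] in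
       \<open>metis mult_nonneg_nonneg of_nat_0_le_iff odd_pos even_diff_nat One_nat_def odd_one even_Suc odd_Suc_minus_one\<close>)

text \<open>Monotonicity keeps the image on the same side of the fixed point as t, and
  \<open>tie_fun_gt\<close> and \<open>tie_fun_lt\<close> move it strictly inwards.\<close>

lemma tie_fun_contracts_odd:
  assumes n: "n \<ge> 2" "odd n" and t: "0 < t" "t < 1" "t \<noteq> tie_fixpoint n"
  shows "\<bar>tie_fun n t - tie_fixpoint n\<bar> < \<bar>t - tie_fixpoint n\<bar>"
  using tie_fun_gt[OF n(1) t(1)] tie_fun_lt[OF n(1) _ t(2)] tie_fixpoint[OF n(1)]
    tie_fun_mono_odd[OF n(2), of t "tie_fixpoint n"] tie_fun_mono_odd[OF n(2), of "tie_fixpoint n" t] t(3)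
  by linarith

section \<open>Contraction for even n, by pairing antipodal nodes\<close>

lemma sum_tie_node_pairs:
  fixes g :: "real \<Rightarrow> real"
  shows "(\<Sum>l<4 * n + 4. g (tie_node n l)) = (\<Sum>l<2 * n + 2. g (tie_node n l) + g (- tie_node n l))"
proof -
  let ?N = "2 * n + 2"
  have "(\<Sum>l<?N + N. g (tie_node n l)) = (\<Sum>l<?N. g (tie_node n l)) + (\<Sum>l<N. g (tie_node n (l + ?N)))" for N
    by (induction N) (simp_all add: add_ac)
  moreover have "4 * n + 4 = ?N + ?N" by simp
  ultimately show ?thesis
    by (simp only: tie_node_antipodal sum.distrib)
qed

text \<open>The left side is the joint contribution of the nodes c and -c to the derivative.
  Equality holds at t = 0 and at c = 1; the general case is convexity of x^M on the nonnegative
  reals.\<close>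

lemma odd_power_pair_bound:
  fixes t c :: real
  assumes M: "odd M" and t: "0 \<le> t" "t \<le> 1/2" and c: "0 \<le> c" "c \<le> 1"
  shows "(t + (1 - t) * c) ^ M * (1 - c) + (t - (1 - t) * c) ^ M * (1 + c) \<ge> - 2 * (1 - 2 * t) ^ M * c ^ Suc M"
proof -
  define A where "A = (1 - t) * c + t"
  define B where "B = (1 - 2 * t) * c"
  have A: "A \<ge> 0" and B: "B \<ge> 0" using t c by (auto simp: A_def B_def)
  show ?thesis
  proof (cases "(1 - t) * c \<le> t")
    case True
    have "0 \<le> (t + (1 - t) * c) ^ M * (1 - c) + (t - (1 - t) * c) ^ M * (1 + c)"
      using True A c t by (intro add_nonneg_nonneg mult_nonneg_nonneg zero_le_power) auto
    moreover have "0 \<le> (1 - 2 * t) ^ M * c ^ Suc M"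
      using t c by (intro mult_nonneg_nonneg zero_le_power) auto
    ultimately show ?thesis by simp
  next
    case False
    define y where "y = (1 - t) * c - t"
    have y: "y > 0" using False by (simp add: y_def)
    \<comment> \<open>The weight solves (1 + c)(1 - w) = 1 - c: after multiplication by 1 + c the
      term in \<open>A\<close> cancels exactly against the positive summand, and the term in
      \<open>B\<close> is the claimed bound.\<close>
    define w where "w = 2 * c / (1 + c)"
    have w: "0 \<le> w" "w \<le> 1" "(1 + c) * w = 2 * c" "(1 + c) * (1 - w) = 1 - c"
      using c by (auto simp: w_def field_simps)
    have "(1 + c) * ((1 - w) * A + w * B) - (1 + c) * y = (1 - c) * A + 2 * c * B - (1 + c) * y"
      using w(3,4) by (simp only: distrib_left mult.assoc[symmetric])
    also have "\<dots> = 2 * t * (1 - c * c)"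
      by (simp add: A_def B_def y_def algebra_simps)
    also have "\<dots> \<ge> 0" using t c by (simp add: mult_le_one)
    finally have "y \<le> (1 - w) * A + w * B" using c by simp
    then have "y ^ M \<le> ((1 - w) * A + w * B) ^ M" using y by (intro power_mono) auto
    also have "\<dots> \<le> (1 - w) * A ^ M + w * B ^ M"
      using convex_onD[OF convex_power_odd[OF M], of w A B] w A B by simp
    finally have "(1 + c) * y ^ M \<le> (1 + c) * ((1 - w) * A ^ M + w * B ^ M)"
      using c by (intro mult_left_mono) auto
    also have "\<dots> = (1 - c) * A ^ M + 2 * c * B ^ M"
      using w(3,4) by (simp only: distrib_left mult.assoc[symmetric])
    finally have "(1 + c) * y ^ M \<le> (1 - c) * A ^ M + 2 * (1 - 2 * t) ^ M * c ^ Suc M"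
      by (simp add: B_def power_mult_distrib mult_ac)
    moreover have "(t - (1 - t) * c) ^ M = - (y ^ M)"
      unfolding y_def by (metis M minus_diff_eq power_minus_odd)
    ultimately show ?thesis by (simp add: A_def algebra_simps)
  qed
qed

text \<open>Summing over the pairs turns the c^n of the pairwise bound back into the average that is
  \<open>tie_fun n 0\<close>.\<close>

lemma tie_fun_deriv_ge:
  assumes n: "even n" "n \<ge> 2" and t: "0 \<le> t" "t \<le> 1/2"
  shows "tie_moment n 1 (n - 1) t \<ge> - (tie_fun n 0 * (1 - 2 * t) ^ (n - 1))"
proof -
  let ?M = "n - 1"
  have M: "odd ?M" "Suc ?M = n" using n by auto
  \<comment> \<open>For negative c the bound is applied to -c, which swaps the two summands and, n
    being even, keeps c^n.\<close>
  have pt: "- 2 * (1 - 2 * t) ^ ?M * c ^ n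
      \<le> (t + (1 - t) * c) ^ ?M * (1 - c) + (t - (1 - t) * c) ^ ?M * (1 + c)"
    if "-1 \<le> c" "c \<le> 1" for c
    using odd_power_pair_bound[OF M(1) t, of c] odd_power_pair_bound[OF M(1) t, of "- c"] that n M
    by (cases "c \<ge> 0") auto
  have "- (tie_fun n 0 * (1 - 2 * t) ^ ?M) * (4 * n + 4)
      = - (\<Sum>l<4 * n + 4. tie_node n l ^ n) * (1 - 2 * t) ^ ?M"
    by (simp add: tie_fun_eq_moment tie_moment_def)
  also have "\<dots> = (\<Sum>l<2 * n + 2. - 2 * (1 - 2 * t) ^ ?M * tie_node n l ^ n)"
    unfolding sum_tie_node_pairs[where g = "\<lambda>x. x ^ n"]
    unfolding sum_negf[symmetric] sum_distrib_right using n(1) by (intro sum.cong) auto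
  also have "\<dots> \<le> (\<Sum>l<2 * n + 2. (t + (1 - t) * tie_node n l) ^ ?M * (1 - tie_node n l)
      + (t - (1 - t) * tie_node n l) ^ ?M * (1 + tie_node n l))"
    by (intro sum_mono pt tie_node_bounds)
  also have "\<dots> = tie_moment n 1 ?M t * (4 * n + 4)"
    using sum_tie_node_pairs[where g = "\<lambda>x. (t + (1 - t) * x) ^ ?M * (1 - x)" and n = n]
    by (simp add: tie_moment_def)
  finally show ?thesis
    by (subst (asm) mult_le_cancel_right_pos) auto
qed

lemma tie_fun_deriv_nonneg:
  assumes t: "1/2 \<le> t" "t \<le> 1"
  shows "tie_moment n 1 m t \<ge> 0"
proof -
  have "0 \<le> t + (1 - t) * tie_node n l" for l
  proof -
    have "(1 - t) * (-1) \<le> (1 - t) * tie_node n l"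
      using t tie_node_bounds by (intro mult_left_mono) auto
    then show ?thesis using t by simp
  qed
  then show ?thesis
    unfolding tie_moment_def using tie_node_bounds
    by (intro divide_nonneg_pos sum_nonneg mult_nonneg_nonneg zero_le_power) auto
qed

text \<open>In each pair one node c is nonnegative, and t + (1 - t) c lies between c and 1, so its
  power is at least c^n; the other even power is dropped. Keeping one node of each pair costs the
  factor 1/2.\<close>

lemma tie_fun_even_ge:
  assumes n: "even n" and t: "0 \<le> t" "t \<le> 1"
  shows "tie_fun n 0 / 2 \<le> tie_fun n t"
proof -
  have abs_le: "c ^ n \<le> (t + (1 - t) * c) ^ n" if "0 \<le> c" "c \<le> 1" for c :: real
    using t that mult_left_mono[of c 1 t] by (intro power_mono) (auto simp: algebra_simps)
  have pt: "c ^ n \<le> (t + (1 - t) * c) ^ n + (t + (1 - t) * (- c)) ^ n" if "-1 \<le> c" "c \<le> 1" for c :: real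
    using abs_le[of c] abs_le[of "- c"] that n
      zero_le_even_power[OF n, of "t + (1 - t) * c"] zero_le_even_power[OF n, of "t + (1 - t) * (- c)"]
    by (cases "c \<ge> 0") auto
  have "tie_fun n 0 / 2 * (4 * n + 4) = (\<Sum>l<4 * n + 4. tie_node n l ^ n) / 2"
    by (simp add: tie_fun_eq_moment tie_moment_def field_simps)
  also have "\<dots> = (\<Sum>l<2 * n + 2. tie_node n l ^ n)"
    unfolding sum_tie_node_pairs[where g = "\<lambda>x. x ^ n"] sum_divide_distrib
    using n by (intro sum.cong) auto
  also have "\<dots> \<le> (\<Sum>l<2 * n + 2. (t + (1 - t) * tie_node n l) ^ n + (t + (1 - t) * (- tie_node n l)) ^ n)"
    by (intro sum_mono pt tie_node_bounds)
  also have "\<dots> = tie_fun n t * (4 * n + 4)"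
    using sum_tie_node_pairs[where g = "\<lambda>x. (t + (1 - t) * x) ^ n" and n = n]
    by (simp add: tie_fun_eq_moment tie_moment_def)
  finally show ?thesis
    by (subst (asm) mult_le_cancel_right_pos) auto
qed

text \<open>Strictness comes from the outcome n of the binomial variable: it has probability b^n > 0
  and differs from the outcome 1 because n >= 2.\<close>

lemma mult_power_lt_1:
  fixes b :: real
  assumes "0 < b" "b \<le> 1" "n \<ge> 2"
  shows "n * b * (1 - b) ^ (n - 1) < 1"
proof -
  have "n * b * (1 - b) ^ (n - 1) + b ^ n = (\<Sum>N\<in>{1, n}. real (n choose N) * b ^ N * (1 - b) ^ (n - N))"
    using assms by simp
  also have "\<dots> \<le> (\<Sum>N\<le>n. real (n choose N) * b ^ N * (1 - b) ^ (n - N))"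
    using assms by (intro sum_mono2) auto
  also have "\<dots> = 1"
    using binomial_ring[of b "1 - b" n] by simp
  finally show ?thesis using assms zero_less_power[of b n] by linarith
qed

text \<open>With b the value at 0, the derivative exceeds -1 from b/2 on, since n b (1 - b)^(n - 1) is
  the probability that a binomial variable equals 1.\<close>

lemma tie_fun_contracts_even:
  assumes n: "n \<ge> 2" "even n"
  obtains c where "0 < c" "c < tie_fun n 0 / 2"
    "\<And>t. c \<le> t \<Longrightarrow> t < 1 \<Longrightarrow> t \<noteq> tie_fixpoint n \<Longrightarrow> \<bar>tie_fun n t - tie_fixpoint n\<bar> < \<bar>t - tie_fixpoint n\<bar>"
proof -
  let ?b = "tie_fun n 0" and ?a = "tie_fixpoint n"
  have b: "0 < ?b" "?b \<le> 1"
    using n tie_fun_le_1[of 0 n] by (auto simp: tie_fun_0)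
  \<comment> \<open>A perturbed orbit is only known to exceed eventually each value below b/2, so
    \<open>c\<close> must lie strictly below b/2; the strict inequality at b/2 persists slightly to
    its left by continuity.\<close>
  have "((\<lambda>x. n * ?b * (1 - 2 * x) ^ (n - 1)) \<longlongrightarrow> n * ?b * (1 - 2 * (?b / 2)) ^ (n - 1)) (at_left (?b / 2))"
    by (intro tendsto_intros)
  then have "\<forall>\<^sub>F x in at_left (?b / 2). n * ?b * (1 - 2 * x) ^ (n - 1) < 1"
    using mult_power_lt_1[OF b n(1)] by (intro order_tendstoD) auto
  moreover have "\<forall>\<^sub>F x in at_left (?b / 2). 0 < x \<and> x < ?b / 2"
    using b eventually_at_left[of 0 "?b / 2"] by (auto intro!: exI[of _ 0])
  ultimately have "\<forall>\<^sub>F x in at_left (?b / 2). n * ?b * (1 - 2 * x) ^ (n - 1) < 1 \<and> 0 < x \<and> x < ?b / 2"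
    by eventually_elim auto
  then obtain c where c: "n * ?b * (1 - 2 * c) ^ (n - 1) < 1" "0 < c" "c < ?b / 2"
    using eventually_happens trivial_limit_at_left_real by blast
  have deriv: "n * tie_moment n 1 (n - 1) x > -1" if x: "c \<le> x" "x \<le> 1" for x
  proof (cases "x \<le> 1/2")
    case True
    have "n * (?b * (1 - 2 * x) ^ (n - 1)) \<le> n * (?b * (1 - 2 * c) ^ (n - 1))"
      using True x b c by (intro mult_left_mono power_mono) auto
    moreover have "n * - (?b * (1 - 2 * x) ^ (n - 1)) \<le> n * tie_moment n 1 (n - 1) x"
      using tie_fun_deriv_ge[OF n(2,1), of x] True x c by (intro mult_left_mono) auto
    ultimately show ?thesis using c(1) by (simp add: mult_ac)
  next
    case False
    then have "0 \<le> n * tie_moment n 1 (n - 1) x"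
      using tie_fun_deriv_nonneg[of x n "n - 1"] x by simp
    then show ?thesis by linarith
  qed
  \<comment> \<open>A slope above -1 lets the image jump across the fixed point only to a strictly
    smaller distance; images that stay on the side of t are handled by \<open>tie_fun_gt\<close> and
    \<open>tie_fun_lt\<close>.\<close>
  have incr: "tie_fun n s + s < tie_fun n t + t" if "c \<le> s" "s < t" "t \<le> 1" for s t
  proof (rule DERIV_pos_imp_increasing[OF that(2)])
    fix x assume "s \<le> x" "x \<le> t"
    then have "((\<lambda>x. tie_fun n x + x) has_real_derivative n * tie_moment n 1 (n - 1) x + 1) (at x)"
      "n * tie_moment n 1 (n - 1) x + 1 > 0"
      using deriv[of x] that by (auto intro!: derivative_eq_intros tie_fun_deriv)
    then show "\<exists>y. ((\<lambda>x. tie_fun n x + x) has_real_derivative y) (at x) \<and> 0 < y" by blast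
  qed
  have a: "c < ?a"
    using tie_fun_even_ge[OF n(2), of ?a] tie_fixpoint[OF n(1)] c by auto
  show ?thesis
  proof (rule that[OF c(2,3)])
    fix t assume t: "c \<le> t" "t < 1" "t \<noteq> ?a"
    show "\<bar>tie_fun n t - ?a\<bar> < \<bar>t - ?a\<bar>"
      using t a c incr[of t ?a] incr[of ?a t] tie_fun_gt[OF n(1), of t] tie_fun_lt[OF n(1), of t]
        tie_fixpoint[OF n(1)] by linarith
  qed
qed

text \<open>The contraction need not be uniform, but among the points of the interval at distance at
  least e from a, a compact set, the decrease has a positive minimum. Once the error is below half
  of it, large distances shrink by a fixed amount per step, so the orbit must enter the
  e-ball.\<close>

lemma perturbed_contraction_tendsto:
  fixes f :: "real \<Rightarrow> real" and x :: "nat \<Rightarrow> real"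
  assumes cont: "continuous_on {lo..hi} f"
    and contr: "\<And>t. lo \<le> t \<Longrightarrow> t \<le> hi \<Longrightarrow> t \<noteq> a \<Longrightarrow> \<bar>f t - a\<bar> < \<bar>t - a\<bar>"
    and fa: "f a = a"
    and ev: "\<forall>\<^sub>F m in sequentially. lo \<le> x m \<and> x m \<le> hi"
    and err: "(\<lambda>m. x (Suc m) - f (x m)) \<longlonglongrightarrow> 0"
  shows "x \<longlonglongrightarrow> a"
proof (rule LIMSEQ_I)
  fix r :: real assume r: "r > 0"
  define e where "e = r / 2"
  have e: "e > 0" using r by (simp add: e_def)
  define S where "S = {lo..hi} \<inter> {t. e \<le> \<bar>t - a\<bar>}"
  have "\<exists>\<eta>>0. \<forall>t\<in>S. \<eta> \<le> \<bar>t - a\<bar> - \<bar>f t - a\<bar>"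
  proof (cases "S = {}")
    case False
    have "closed {t. e \<le> \<bar>t - a\<bar>}"
      by (intro closed_Collect_le continuous_intros)
    then have "compact S" unfolding S_def by (intro compact_Int_closed) auto
    moreover have "continuous_on S (\<lambda>t. \<bar>t - a\<bar> - \<bar>f t - a\<bar>)"
      using continuous_on_subset[OF cont] by (intro continuous_intros) (auto simp: S_def)
    ultimately obtain t0 where t0: "t0 \<in> S" "\<And>t. t \<in> S \<Longrightarrow> \<bar>t0 - a\<bar> - \<bar>f t0 - a\<bar> \<le> \<bar>t - a\<bar> - \<bar>f t - a\<bar>"
      using continuous_attains_inf[of S "\<lambda>t. \<bar>t - a\<bar> - \<bar>f t - a\<bar>"] False by blast
    with contr[of t0] e show ?thesis
      by (intro exI[of _ "\<bar>t0 - a\<bar> - \<bar>f t0 - a\<bar>"]) (auto simp: S_def)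
  qed (auto intro: exI[of _ 1])
  then obtain \<eta>' where \<eta>': "\<eta>' > 0" "\<And>t. t \<in> S \<Longrightarrow> \<eta>' \<le> \<bar>t - a\<bar> - \<bar>f t - a\<bar>" by blast
  \<comment> \<open>The cap at e keeps the error below e/2, so a step from inside the e-ball ends
    within 2 e = r.\<close>
  define \<eta> where "\<eta> = min \<eta>' e"
  have \<eta>: "\<eta> > 0" "\<eta> \<le> e" "\<And>t. t \<in> S \<Longrightarrow> \<eta> \<le> \<bar>t - a\<bar> - \<bar>f t - a\<bar>"
    using \<eta>' e by (force simp: \<eta>_def)+
  from LIMSEQ_D[OF err, of "\<eta> / 2"] \<eta>(1)
  have "\<forall>\<^sub>F m in sequentially. \<bar>x (Suc m) - f (x m)\<bar> < \<eta> / 2"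
    by (auto simp: eventually_sequentially)
  with ev have "\<forall>\<^sub>F m in sequentially. lo \<le> x m \<and> x m \<le> hi \<and> \<bar>x (Suc m) - f (x m)\<bar> < \<eta> / 2"
    by eventually_elim auto
  then obtain M where M: "\<And>m. m \<ge> M \<Longrightarrow> lo \<le> x m \<and> x m \<le> hi \<and> \<bar>x (Suc m) - f (x m)\<bar> < \<eta> / 2"
    by (auto simp: eventually_sequentially)
  have far: "\<bar>x (Suc m) - a\<bar> \<le> \<bar>x m - a\<bar> - \<eta> / 2" if "m \<ge> M" "\<bar>x m - a\<bar> \<ge> e" for m
  proof -
    have "\<eta> \<le> \<bar>x m - a\<bar> - \<bar>f (x m) - a\<bar>"
      using M[OF that(1)] that(2) by (intro \<eta>(3)) (auto simp: S_def)
    then show ?thesis using M[OF that(1)] by linarith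
  qed
  have near: "\<bar>x (Suc m) - a\<bar> < 2 * e" if "m \<ge> M" "\<bar>x m - a\<bar> < e" for m
  proof -
    have "\<bar>f (x m) - a\<bar> \<le> \<bar>x m - a\<bar>"
      using M[OF that(1)] contr[of "x m"] fa by (cases "x m = a") auto
    then show ?thesis using M[OF that(1)] that(2) \<eta>(2) e by linarith
  qed
  have "\<exists>m\<ge>M. \<bar>x m - a\<bar> < e"
  proof (rule ccontr)
    assume "\<not> ?thesis"
    then have all: "\<bar>x m - a\<bar> \<ge> e" if "m \<ge> M" for m using that by force
    have dec: "\<bar>x (M + j) - a\<bar> \<le> \<bar>x M - a\<bar> - j * (\<eta> / 2)" for j
    proof (induction j)
      case (Suc j)
      then show ?case using far[of "M + j"] all[of "M + j"] by (simp add: algebra_simps add_divide_distrib)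
    qed simp
    obtain j :: nat where "j * (\<eta> / 2) > \<bar>x M - a\<bar>"
      using reals_Archimedean3[of "\<eta> / 2"] \<eta>(1) by auto
    with dec[of j] abs_ge_zero[of "x (M + j) - a"] show False by linarith
  qed
  then obtain m0 where m0: "m0 \<ge> M" "\<bar>x m0 - a\<bar> < e" by blast
  have "\<bar>x m - a\<bar> < 2 * e" if "m \<ge> m0" for m
    using that
  proof (induction m rule: dec_induct)
    case base then show ?case using m0 e by simp
  next
    case (step m)
    then show ?case using far[of m] near[of m] m0 \<eta>(1) by (cases "\<bar>x m - a\<bar> < e") auto
  qed
  then show "\<exists>no. \<forall>m\<ge>no. norm (x m - a) < r"
    by (auto simp: e_def)
qed

section \<open>Recursion for the law of the root\<close>

lemma votes_eq_0: "(\<And>x. x < n \<Longrightarrow> c x \<noteq> i) \<Longrightarrow> votes n c i = 0"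
  unfolding votes_def by (metis (mono_tags, lifting) card.empty empty_Collect_eq)

lemma votes_pos: "x < n \<Longrightarrow> c x = i \<Longrightarrow> 0 < votes n c i"
  unfolding votes_def by (subst card_gt_0_iff) auto

lemma wins_unique: "wins n k c i \<Longrightarrow> wins n k c j \<Longrightarrow> i = j"
  unfolding wins_def by (metis Diff_iff less_asym singletonD)

text \<open>With k >= 2 a winner strictly beats some rival and so has at least one vote; hence the
  clause for all children undecided cannot override it.\<close>

lemma parent_state_eq_iff:
  assumes k: "k \<ge> 2" and i: "i \<noteq> 0"
  shows "parent_state n k c = i \<longleftrightarrow> wins n k c i"
proof -
  have winner: "parent_state n k c = j" if w: "wins n k c j" for j
  proof -
    have j: "j \<noteq> 0" using w by (auto simp: wins_def)
    have "(if j = 1 then 2 else 1) \<in> {1..k} - {j}" using k by auto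
    then have "votes n c j > 0" using w unfolding wins_def by fastforce
    then have "\<exists>x<n. c x = j" using votes_eq_0[of n c j] by (cases "\<exists>x<n. c x = j") auto
    then have nz: "\<not> (\<forall>x<n. c x = 0)" using j by auto
    have "(THE i. wins n k c i) = j"
      by (rule the_equality[of "wins n k c", OF w wins_unique[OF _ w]])
    then show ?thesis
      unfolding parent_state_def using nz w by auto
  qed
  have "\<exists>j. wins n k c j" if "parent_state n k c = i"
    using that i unfolding parent_state_def by (auto split: if_splits)
  then show ?thesis using winner by metis
qed

lemma parent_state_eq_0:
  assumes "k \<ge> 2" "\<And>i. i \<in> {1..k} \<Longrightarrow> \<exists>j\<in>{1..k} - {i}. votes n c i \<le> votes n c j"
  shows "parent_state n k c = 0"
proof (rule ccontr)
  assume "parent_state n k c \<noteq> 0"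
  then have "wins n k c (parent_state n k c)"
    using parent_state_eq_iff[OF assms(1)] by blast
  then show False using assms(2) unfolding wins_def by (metis leD)
qed

lemma parent_state_le: "k \<ge> 2 \<Longrightarrow> parent_state n k c \<le> k"
  using parent_state_eq_iff[of k "parent_state n k c" n c] by (cases "parent_state n k c = 0") (auto simp: wins_def)

section \<open>Independence of the subtrees below the root\<close>

lemma finite_leaves: "finite (leaves n m)"
  unfolding leaves_def using finite_lists_length_eq[of "{..<n}" m] by (simp add: conj_commute)

lemma leaves_Suc: "leaves n (Suc m) = (\<lambda>(x, u). x # u) ` ({..<n} \<times> leaves n m)"
  by (auto simp: leaves_def image_iff length_Suc_conv)

text \<open>Children are appended at the end of a word, whereas splitting the tree at the root
  removes the first letter; this reconciles the two.\<close>

lemma node_state_Cons: "node_state n k w h (x # v) = node_state n k (\<lambda>u. w (x # u)) h v"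
  by (induction h arbitrary: v) simp_all

lemma node_state_0: "node_state n k (\<lambda>_. 0) h v = 0"
  by (induction h arbitrary: v) (simp_all add: parent_state_def)

text \<open>The leaf configurations of the n subtrees are independent, and \<open>glue\<close>
  assembles them. Defaults need care: \<open>[]\<close> is not a leaf of the larger tree and gets 0,
  and an index outside \<open>{..<n}\<close> carries the zero function.\<close>

lemma Pi_pmf_leaves_Suc:
  fixes D :: "nat pmf"
  defines "glue \<equiv> \<lambda>F v. case v of [] \<Rightarrow> 0 | x # u \<Rightarrow> F x u"
  shows "Pi_pmf (leaves n (Suc m)) 0 (\<lambda>_. D)
    = map_pmf glue (Pi_pmf {..<n} (\<lambda>_. 0) (\<lambda>_. Pi_pmf (leaves n m) 0 (\<lambda>_. D)))"
    (is "?A = map_pmf glue ?B")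
proof (rule pmf_eqI)
  fix w
  have inj: "inj glue"
  proof (rule injI, intro ext)
    fix F G x u assume "glue F = glue G"
    from fun_cong[OF this, of "x # u"] show "F x u = G x u" by (simp add: glue_def)
  qed
  have nil: "[] \<notin> leaves n (Suc m)" by (simp add: leaves_def)
  show "pmf ?A w = pmf (map_pmf glue ?B) w"
  proof (cases "w [] = 0")
    case False
    then have "pmf ?A w = 0" using nil by (intro pmf_Pi_outside finite_leaves) auto
    moreover have "w \<notin> range glue" using False by (auto simp: glue_def)
    then have "pmf (map_pmf glue ?B) w = 0" by (intro pmf_map_outside) auto
    ultimately show ?thesis by simp
  next
    case True
    define F where "F x u = w (x # u)" for x u
    have w: "w = glue F"
      using True by (auto simp: glue_def F_def fun_eq_iff split: list.splits)
    \<comment> \<open>The two default conditions agree, so either both probabilities vanish for this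
      reason or both are the same product over leaves.\<close>
    have dflt: "(\<forall>v. v \<notin> leaves n (Suc m) \<longrightarrow> w v = 0)
      \<longleftrightarrow> (\<forall>x. x \<notin> {..<n} \<longrightarrow> F x = (\<lambda>_. 0)) \<and> (\<forall>x\<in>{..<n}. \<forall>u. u \<notin> leaves n m \<longrightarrow> F x u = 0)"
      (is "?l \<longleftrightarrow> ?r")
    proof
      assume ?l then show ?r by (auto simp: F_def leaves_Suc fun_eq_iff)
    next
      assume r: ?r
      show ?l
      proof (intro allI impI)
        fix v assume v: "v \<notin> leaves n (Suc m)"
        show "w v = 0"
        proof (cases v)
          case (Cons x u)
          then have "x \<notin> {..<n} \<or> u \<notin> leaves n m"
            using v by (auto simp: leaves_Suc)
          then have "F x u = 0" using r by (cases "x \<in> {..<n}") (simp_all del: lessThan_iff)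
          then show ?thesis by (simp add: F_def Cons)
        qed (simp add: True)
      qed
    qed
    have "pmf (map_pmf glue ?B) w = pmf ?B F"
      unfolding w by (rule pmf_map_inj'[OF inj])
    also have "\<dots> = (if \<forall>v. v \<notin> leaves n (Suc m) \<longrightarrow> w v = 0
        then \<Prod>x<n. \<Prod>u\<in>leaves n m. pmf D (F x u) else 0)"
    proof (cases "\<forall>x\<in>{..<n}. \<forall>u. u \<notin> leaves n m \<longrightarrow> F x u = 0")
      case True
      then show ?thesis unfolding dflt by (auto simp: pmf_Pi finite_leaves intro!: prod.cong)
    next
      case False
      then obtain x where "x < n" "\<exists>u. u \<notin> leaves n m \<and> F x u \<noteq> 0" by auto
      then have "x < n" "pmf (Pi_pmf (leaves n m) 0 (\<lambda>_. D)) (F x) = 0"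
        by (auto intro: pmf_Pi_outside[OF finite_leaves])
      then have "(\<Prod>x<n. pmf (Pi_pmf (leaves n m) 0 (\<lambda>_. D)) (F x)) = 0"
        by (intro prod_zero) auto
      then have "pmf ?B F = 0" by (simp only: pmf_Pi[OF finite_lessThan] if_cancel)
      then show ?thesis using False unfolding dflt by (simp only: simp_thms if_False)
    qed
    also have "(\<Prod>x<n. \<Prod>u\<in>leaves n m. pmf D (F x u)) = (\<Prod>v\<in>leaves n (Suc m). pmf D (w v))"
      unfolding leaves_Suc
      by (subst prod.reindex) (auto simp: inj_on_def prod.cartesian_product F_def intro!: prod.cong)
    finally show ?thesis by (simp add: pmf_Pi finite_leaves)
  qed
qed

lemma root_pmf_Suc:
  "root_pmf n k p (Suc m) = map_pmf (parent_state n k) (Pi_pmf {..<n} 0 (\<lambda>_. root_pmf n k p m))"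
proof -
  let ?D = "leaf_pmf k p"
  have "root_pmf n k p (Suc m)
    = map_pmf (\<lambda>F. parent_state n k (\<lambda>x. node_state n k (F x) m []))
        (Pi_pmf {..<n} (\<lambda>_. 0) (\<lambda>_. Pi_pmf (leaves n m) 0 (\<lambda>_. ?D)))"
    unfolding root_pmf_def Pi_pmf_leaves_Suc by (simp add: pmf.map_comp o_def node_state_Cons)
  also have "\<dots> = map_pmf (parent_state n k)
      (map_pmf (\<lambda>F. (\<lambda>w. node_state n k w m []) \<circ> F)
        (Pi_pmf {..<n} (\<lambda>_. 0) (\<lambda>_. Pi_pmf (leaves n m) 0 (\<lambda>_. ?D))))"
    by (simp add: pmf.map_comp o_def)
  also have "map_pmf (\<lambda>F. (\<lambda>w. node_state n k w m []) \<circ> F)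
        (Pi_pmf {..<n} (\<lambda>_. 0) (\<lambda>_. Pi_pmf (leaves n m) 0 (\<lambda>_. ?D)))
      = Pi_pmf {..<n} 0 (\<lambda>_. root_pmf n k p m)"
    unfolding root_pmf_def by (rule Pi_pmf_map[symmetric]) (auto simp: node_state_0)
  finally show ?thesis .
qed

lemma root_pmf_0: "root_pmf n k p 0 = leaf_pmf k p"
proof -
  have "leaves n 0 = {[]}" by (auto simp: leaves_def)
  then show ?thesis
    by (simp add: root_pmf_def Pi_pmf_singleton pmf.map_comp o_def)
qed

section \<open>The vote as a finite weighted sum over configurations\<close>

definition configs :: "nat \<Rightarrow> nat set \<Rightarrow> (nat \<Rightarrow> nat) set" where
  "configs n B = PiE_dflt {..<n} 0 (\<lambda>_. B)"

text \<open>The ring is general because ties will be detected with complex weights.\<close>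

definition weight :: "nat \<Rightarrow> (nat \<Rightarrow> 'a::comm_ring_1) \<Rightarrow> (nat \<Rightarrow> nat) \<Rightarrow> 'a" where
  "weight n q c = (\<Prod>x<n. q (c x))"

text \<open>On probability vectors this is the map H of one generation, summed over the states of
  the individual children; the multinomial coefficients of H count these configurations by their
  numbers of votes.\<close>

definition vote_law :: "nat \<Rightarrow> nat \<Rightarrow> (nat \<Rightarrow> real) \<Rightarrow> nat \<Rightarrow> real" where
  "vote_law n k q i = (\<Sum>c | c \<in> configs n {..k} \<and> parent_state n k c = i. weight n q c)"

lemma finite_configs [simp]: "finite B \<Longrightarrow> finite (configs n B)"
  unfolding configs_def by auto

lemma configsD: "c \<in> configs n B \<Longrightarrow> x < n \<Longrightarrow> c x \<in> B"
  by (auto simp: configs_def PiE_dflt_def)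

lemma root_law_Suc:
  assumes supp: "\<And>i. i > k \<Longrightarrow> root_law n k p m i = 0"
  shows "root_law n k p (Suc m) i = vote_law n k (root_law n k p m) i"
proof -
  let ?P = "Pi_pmf {..<n} 0 (\<lambda>_. root_pmf n k p m)"
  have fin: "finite {c \<in> configs n {..k}. parent_state n k c = i}" by simp
  have sub: "set_pmf ?P \<subseteq> configs n {..k}"
    using supp unfolding configs_def set_Pi_pmf[OF finite_lessThan] PiE_dflt_def root_law_def
    by (force simp: set_pmf_eq not_le[symmetric])
  have "root_law n k p (Suc m) i = measure_pmf.prob ?P (parent_state n k -` {i})"
    by (simp add: root_law_def root_pmf_Suc pmf_map)
  also have "\<dots> = measure_pmf.prob ?P {c \<in> configs n {..k}. parent_state n k c = i}"
    using sub by (intro measure_prob_cong_0) (auto simp: set_pmf_eq)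
  also have "\<dots> = (\<Sum>c | c \<in> configs n {..k} \<and> parent_state n k c = i. pmf ?P c)"
    by (rule measure_measure_pmf_finite[OF fin])
  also have "\<dots> = vote_law n k (root_law n k p m) i"
    unfolding vote_law_def weight_def root_law_def
    by (intro sum.cong refl, subst pmf_Pi') (auto simp: configs_def PiE_dflt_def)
  finally show ?thesis .
qed

lemma vote_law_gt_k: "k \<ge> 2 \<Longrightarrow> i > k \<Longrightarrow> vote_law n k q i = 0"
  unfolding vote_law_def using parent_state_le[of k n] by (intro sum.neutral) (auto simp: not_le[symmetric])

lemma root_law_0: "p \<in> opinion_simplex k \<Longrightarrow> root_law n k p 0 i = (if i \<le> k then p i else 0)"
  by (simp add: root_law_def root_pmf_0 pmf_leaf_pmf)

lemma root_law_gt_k: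
  assumes "k \<ge> 2" "p \<in> opinion_simplex k" "i > k"
  shows "root_law n k p m i = 0"
  using assms(3)
proof (induction m arbitrary: i)
  case (Suc m)
  then show ?case by (subst root_law_Suc) (auto intro: vote_law_gt_k[OF assms(1)])
qed (simp add: root_law_0 assms)

lemma sum_PiE_dflt_prod:
  fixes f :: "'a \<Rightarrow> 'b \<Rightarrow> 'c :: comm_semiring_1"
  assumes "finite A" "\<And>x. x \<in> A \<Longrightarrow> finite (B x)"
  shows "(\<Sum>c\<in>PiE_dflt A d B. \<Prod>x\<in>A. f x (c x)) = (\<Prod>x\<in>A. \<Sum>i\<in>B x. f x i)"
proof -
  have "(\<Sum>c\<in>PiE_dflt A d B. \<Prod>x\<in>A. f x (c x))
      = (\<Sum>c\<in>PiE A B. \<Prod>x\<in>A. f x (if x \<in> A then c x else d))"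
    unfolding dflt_image_PiE[symmetric]
    by (subst sum.reindex) (auto simp: inj_on_def fun_eq_iff PiE_def extensional_def, metis)
  also have "\<dots> = (\<Sum>c\<in>PiE A B. \<Prod>x\<in>A. f x (c x))"
    by (intro sum.cong prod.cong) auto
  finally show ?thesis using assms by (simp add: prod_sum_PiE)
qed

lemma sum_weight_configs: "finite B \<Longrightarrow> (\<Sum>c\<in>configs n B. weight n q c) = (\<Sum>i\<in>B. q i) ^ n"
  unfolding configs_def weight_def by (subst sum_PiE_dflt_prod) simp_all

lemma weight_votes:
  assumes "c \<in> configs n B" "finite B"
  shows "weight n q c = (\<Prod>i\<in>B. q i ^ votes n c i)"
proof -
  have "weight n q c = (\<Prod>i\<in>B. \<Prod>x\<in>{x \<in> {..<n}. c x = i}. q (c x))"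
    unfolding weight_def using assms by (subst prod.group) (auto dest: configsD)
  also have "\<dots> = (\<Prod>i\<in>B. q i ^ votes n c i)"
    by (simp add: votes_def)
  finally show ?thesis .
qed

lemma weight_nonneg:
  fixes q :: "nat \<Rightarrow> real"
  assumes "\<And>i. i \<in> B \<Longrightarrow> 0 \<le> q i" "c \<in> configs n B"
  shows "0 \<le> weight n q c"
  unfolding weight_def using assms by (auto intro!: prod_nonneg dest: configsD)

text \<open>The event of equally many votes for 1 and 2 is detected by averaging over roots of unity of order n + 1.\<close>

lemma sum_weight_balanced:
  fixes q :: "nat \<Rightarrow> real"
  assumes "q 1 = b" "q 2 = b"
  shows "(\<Sum>c | c \<in> configs n {0, 1, 2} \<and> votes n c 1 = votes n c 2. weight n q c) = tie_poly n (q 0) b"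
proof -
  let ?C = "configs n {0, 1, 2}" and ?L = "n + 1"
  define z :: "nat \<Rightarrow> nat \<Rightarrow> complex" where "z l = (\<lambda>i. if i = 1 then cis (2 * pi * real l / real ?L)
      else if i = 2 then cis (- (2 * pi * real l / real ?L)) else 1)" for l
  have votes_le: "votes n c i \<le> n" for c i
    unfolding votes_def by (rule order.trans[OF card_mono[of "{..<n}"]]) auto
  have weight_z: "weight n (z l) c = cis (2 * pi * of_int (int (votes n c 1) - int (votes n c 2)) / real ?L) ^ l"
    if "c \<in> ?C" for l c
  proof -
    have "weight n (z l) c = cis (2 * pi * real l / real ?L) ^ votes n c 1
        * cis (- (2 * pi * real l / real ?L)) ^ votes n c 2"
      using weight_votes[OF that, of "z l"] by (simp add: z_def)
    also have "\<dots> = cis (2 * pi * of_int (int (votes n c 1) - int (votes n c 2)) / real ?L) ^ l"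
      unfolding Complex.DeMoivre cis_mult
      by (rule arg_cong[of _ _ cis]) (simp add: algebra_simps diff_divide_distrib)
    finally show ?thesis .
  qed
  have ind: "(\<Sum>l<?L. weight n (z l) c) = (if votes n c 1 = votes n c 2 then of_nat ?L else 0)"
    if "c \<in> ?C" for c
    using sum_cis_multiples[of "int (votes n c 1) - int (votes n c 2)" ?L] votes_le[of c 1] votes_le[of c 2]
      weight_z[OF that] by simp
  have "complex_of_real (real ?L * (\<Sum>c | c \<in> ?C \<and> votes n c 1 = votes n c 2. weight n q c))
      = (\<Sum>c | c \<in> ?C \<and> votes n c 1 = votes n c 2. of_nat ?L * complex_of_real (weight n q c))"
    by (simp add: sum_distrib_left)
  also have "\<dots> = (\<Sum>c\<in>?C. (if votes n c 1 = votes n c 2 then of_nat ?L else 0) * complex_of_real (weight n q c))"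
    by (rule sum.mono_neutral_cong_left) auto
  also have "\<dots> = (\<Sum>c\<in>?C. (\<Sum>l<?L. weight n (z l) c) * complex_of_real (weight n q c))"
    using ind by (intro sum.cong) auto
  also have "\<dots> = (\<Sum>l<?L. \<Sum>c\<in>?C. weight n (z l) c * complex_of_real (weight n q c))"
    unfolding sum_distrib_right by (rule sum.swap)
  \<comment> \<open>Weights multiply pointwise, so the sum over configurations becomes an n-th
    power; since both opinions have probability b, its base is the one in
    \<open>tie_poly_cos_average\<close>.\<close>
  also have "\<dots> = (\<Sum>l<?L. \<Sum>c\<in>?C. weight n (\<lambda>i. z l i * complex_of_real (q i)) c)"
    by (simp add: weight_def prod.distrib)
  also have "\<dots> = (\<Sum>l<?L. (\<Sum>i\<in>{0, 1, 2}. z l i * complex_of_real (q i)) ^ n)"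
    by (simp add: sum_weight_configs)
  also have "\<dots> = (\<Sum>l<?L. complex_of_real ((q 0 + 2 * b * cos (2 * pi * real l / real ?L)) ^ n))"
    using assms by (intro sum.cong refl, simp only: of_real_power, intro arg_cong[of _ _ "\<lambda>x. x ^ n"])
      (simp add: z_def complex_eq_iff algebra_simps)
  also have "\<dots> = complex_of_real (real ?L * tie_poly n (q 0) b)"
    by (subst tie_poly_cos_average[of n ?L]) simp_all
  finally show ?thesis
    unfolding of_real_eq_iff by simp
qed

section \<open>Estimates for one step of the vote\<close>

lemma configs_mono: "A \<subseteq> B \<Longrightarrow> configs n A \<subseteq> configs n B"
  unfolding configs_def PiE_dflt_def by auto

lemma vote_law_wins:
  assumes "k \<ge> 2" "i \<noteq> 0"
  shows "vote_law n k q i = (\<Sum>c | c \<in> configs n {..k} \<and> wins n k c i. weight n q c)"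
  unfolding vote_law_def by (simp add: parent_state_eq_iff[OF assms])

lemma weight_le_vote_law:
  assumes "\<And>i. i \<le> k \<Longrightarrow> 0 \<le> q i" "c \<in> configs n {..k}" "parent_state n k c = i"
  shows "weight n q c \<le> vote_law n k q i"
  unfolding vote_law_def using assms by (intro member_le_sum weight_nonneg[of "{..k}"]) auto

lemma sum_vote_law:
  assumes "k \<ge> 2"
  shows "(\<Sum>i\<le>k. vote_law n k q i) = (\<Sum>i\<le>k. q i) ^ n"
proof -
  have "(\<Sum>i\<le>k. vote_law n k q i) = (\<Sum>c\<in>configs n {..k}. weight n q c)"
    unfolding vote_law_def by (rule sum.group) (auto intro: parent_state_le[OF assms])
  then show ?thesis by (simp add: sum_weight_configs)
qed

section \<open>Exchanging two opinions\<close>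

lemma votes_transpose: "votes n (Transposition.transpose i j \<circ> c) l = votes n c (Transposition.transpose i j l)"
proof -
  have "Transposition.transpose i j (c x) = l \<longleftrightarrow> c x = Transposition.transpose i j l" for x
    by (metis transpose_involutory)
  then show ?thesis by (simp add: votes_def)
qed

lemma transpose_mem: "i \<in> S \<Longrightarrow> j \<in> S \<Longrightarrow> Transposition.transpose i j l \<in> S \<longleftrightarrow> l \<in> S"
  by (cases "l = i"; cases "l = j") simp_all

lemma wins_transpose:
  assumes "i \<in> {1..k}" "j \<in> {1..k}"
  shows "wins n k (Transposition.transpose i j \<circ> c) l \<longleftrightarrow> wins n k c (Transposition.transpose i j l)"
proof -
  have eq: "Transposition.transpose i j ` ({1..k} - {l}) = {1..k} - {Transposition.transpose i j l}"
    using assms by (subst image_set_diff) (auto simp: transpose_image_eq)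
  have "(\<forall>m\<in>{1..k} - {Transposition.transpose i j l}. P m) \<longleftrightarrow> (\<forall>m\<in>{1..k} - {l}. P (Transposition.transpose i j m))" for P
    unfolding eq[symmetric] by blast
  then show ?thesis
    unfolding wins_def votes_transpose transpose_mem[OF assms] by simp
qed

lemma bij_betw_transpose_configs:
  assumes "i \<in> {1..k}" "j \<in> {1..k}"
  shows "bij_betw (\<lambda>c. Transposition.transpose i j \<circ> c) {c \<in> configs n {..k}. wins n k c i} {c \<in> configs n {..k}. wins n k c j}"
proof (rule bij_betwI[where g = "\<lambda>c. Transposition.transpose i j \<circ> c"])
  have mem: "Transposition.transpose i j \<circ> c \<in> configs n {..k}" if "c \<in> configs n {..k}" for c
    using that assms transpose_mem[of i "{..k}" j] unfolding configs_def PiE_dflt_def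
    by (auto simp: Transposition.transpose_def)
  show "(\<lambda>c. Transposition.transpose i j \<circ> c) \<in> {c \<in> configs n {..k}. wins n k c i} \<rightarrow> {c \<in> configs n {..k}. wins n k c j}"
    using mem wins_transpose[OF assms] by auto
  show "(\<lambda>c. Transposition.transpose i j \<circ> c) \<in> {c \<in> configs n {..k}. wins n k c j} \<rightarrow> {c \<in> configs n {..k}. wins n k c i}"
    using mem wins_transpose[OF assms] by auto
qed (auto simp: fun_eq_iff)

lemma vote_law_transpose:
  assumes "k \<ge> 2" "i \<in> {1..k}" "j \<in> {1..k}"
  shows "vote_law n k q j = (\<Sum>c | c \<in> configs n {..k} \<and> wins n k c i. weight n q (Transposition.transpose i j \<circ> c))"
  using assms sum.reindex_bij_betw[OF bij_betw_transpose_configs[OF assms(2,3)], of "weight n q" n]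
  by (simp add: vote_law_wins)

lemma vote_law_eq:
  assumes "k \<ge> 2" "i \<in> {1..k}" "j \<in> {1..k}" "q i = q j"
  shows "vote_law n k q i = vote_law n k q j"
proof -
  have "q (Transposition.transpose i j l) = q l" for l by (metis assms(4) transpose_apply_first transpose_apply_second transpose_apply_other)
  then show ?thesis
    unfolding vote_law_transpose[OF assms(1-3)] using assms
    by (simp add: vote_law_wins weight_def)
qed

text \<open>Exchanging i and j in a configuration won by i moves the surplus of i to the stronger opinion j.
  The unanimous configuration contributes the strict gain.\<close>

lemma vote_law_ratio:
  assumes k: "k \<ge> 2" and n: "n > 0" and ij: "i \<in> {1..k}" "j \<in> {1..k}" "i \<noteq> j"
    and q: "\<And>l. l \<le> k \<Longrightarrow> 0 \<le> q l" "q i \<le> q j"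
  shows "q j * vote_law n k q i + (q i * q j ^ n - q j * q i ^ n) \<le> q i * vote_law n k q j"
proof -
  let ?C = "{c \<in> configs n {..k}. wins n k c i}" and ?t = "\<lambda>c. Transposition.transpose i j \<circ> c"
  let ?u = "\<lambda>x. if x < n then i else 0"
  have "?u \<in> configs n {..k}"
    using ij by (auto simp: configs_def PiE_dflt_def)
  moreover have "wins n k ?u i"
  proof -
    have "votes n ?u i > 0" using n by (intro votes_pos[of 0]) auto
    moreover have "votes n ?u l = 0" if "l \<noteq> i" for l using that by (intro votes_eq_0) auto
    ultimately show ?thesis using ij by (auto simp: wins_def)
  qed
  ultimately have u: "?u \<in> ?C" by simp
  have w_u: "weight n q ?u = q i ^ n" "weight n q (?t ?u) = q j ^ n"
    by (simp_all add: weight_def)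
  have w_le: "q j * weight n q c \<le> q i * weight n q (?t c)" if c: "c \<in> ?C" for c
  proof -
    let ?R = "\<Prod>l\<in>{..k} - {i, j}. q l ^ votes n c l"
    have tc: "?t c \<in> configs n {..k}"
      using bij_betwE[OF bij_betw_transpose_configs[OF ij(1,2), of n]] c by auto
    have split: "(\<Prod>l\<le>k. h l) = h i * (h j * (\<Prod>l\<in>{..k} - {i, j}. h l))" for h :: "nat \<Rightarrow> real"
      using ij by (simp add: prod.remove[of "{..k}" i] prod.remove[of "{..k} - {i}" j] Diff_insert2[symmetric] insert_commute)
    have wc: "weight n q c = q i ^ votes n c i * (q j ^ votes n c j * ?R)"
      using c by (subst weight_votes[of c n "{..k}"]) (auto simp: split)
    have wt: "weight n q (?t c) = q i ^ votes n c j * (q j ^ votes n c i * ?R)"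
      by (subst weight_votes[OF tc]) (auto simp: split votes_transpose intro!: prod.cong)
    have R: "?R \<ge> 0" using q by (intro prod_nonneg) auto
    have "votes n c j < votes n c i" using c ij by (auto simp: wins_def)
    \<comment> \<open>The surplus of the winner over j is 1 + d. One vote yields the claimed ratio,
      the other d can only help as q i <= q j; working without division covers q i = 0.\<close>
    then obtain d where d: "votes n c i = Suc (votes n c j) + d"
      using less_iff_Suc_add by auto
    have nn: "0 \<le> q i" "0 \<le> q j" using q ij by auto
    have "q i ^ d * (q i * q j * (q i ^ votes n c j * (q j ^ votes n c j * ?R)))
        \<le> q j ^ d * (q i * q j * (q i ^ votes n c j * (q j ^ votes n c j * ?R)))"
      using nn q(2) R by (intro mult_right_mono power_mono mult_nonneg_nonneg zero_le_power) auto
    then show ?thesis unfolding wc wt d by (simp add: power_add mult_ac)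
  qed
  have "q j * vote_law n k q i + (q i * q j ^ n - q j * q i ^ n)
      = (\<Sum>c\<in>?C - {?u}. q j * weight n q c) + q i * q j ^ n"
    using k ij u w_u by (simp add: vote_law_wins sum_distrib_left[symmetric] sum.remove[of _ ?u] distrib_left)
  also have "\<dots> \<le> (\<Sum>c\<in>?C - {?u}. q i * weight n q (?t c)) + q i * q j ^ n"
    by (intro add_right_mono sum_mono w_le) auto
  also have "\<dots> = q i * vote_law n k q j"
    using u w_u unfolding vote_law_transpose[OF k ij(1,2)]
    by (simp add: sum_distrib_left[symmetric] sum.remove[of _ ?u] distrib_left)
  finally show ?thesis .
qed

lemma vote_law_unanimous:
  assumes k: "k \<ge> 2" and n: "n > 0" and i: "i \<in> {1..k}" and q: "\<And>l. l \<le> k \<Longrightarrow> 0 \<le> q l"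
  shows "q i ^ n \<le> vote_law n k q i"
proof -
  let ?u = "\<lambda>x. if x < n then i else 0"
  have "votes n ?u i > 0" using n by (intro votes_pos[of 0]) auto
  moreover have "votes n ?u l = 0" if "l \<noteq> i" for l using that by (intro votes_eq_0) auto
  ultimately have "parent_state n k ?u = i"
    using i by (subst parent_state_eq_iff[OF k]) (auto simp: wins_def)
  then have "weight n q ?u \<le> vote_law n k q i"
    using i q by (intro weight_le_vote_law) (auto simp: configs_def PiE_dflt_def)
  then show ?thesis by (simp add: weight_def)
qed

lemma vote_law_one_decided:
  assumes k: "k \<ge> 2" and i: "i \<in> {1..k}" and q: "\<And>l. l \<le> k \<Longrightarrow> 0 \<le> q l"
  shows "n * q 0 ^ (n - 1) * q i \<le> vote_law n k q i"
proof -
  let ?u = "\<lambda>x y. if y = x then i else 0"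
  have inj: "inj_on ?u {..<n}"
    using i by (auto simp: inj_on_def fun_eq_iff split: if_splits)
  have w: "weight n q (?u x) = q 0 ^ (n - 1) * q i" if "x < n" for x
    using that unfolding weight_def by (subst prod.remove[of _ x]) auto
  have win: "wins n k (?u x) i" if "x < n" for x
  proof -
    have "votes n (?u x) i > 0" using that by (intro votes_pos[of x]) auto
    moreover have "votes n (?u x) l = 0" if "l \<noteq> i" "l \<noteq> 0" for l using that by (intro votes_eq_0) auto
    ultimately show ?thesis using i by (auto simp: wins_def)
  qed
  have "n * q 0 ^ (n - 1) * q i = (\<Sum>x<n. weight n q (?u x))"
    by (simp add: w)
  also have "\<dots> = (\<Sum>c\<in>?u ` {..<n}. weight n q c)"
    by (simp add: sum.reindex[OF inj])
  also have "\<dots> \<le> vote_law n k q i"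
    using i win q
    by (subst vote_law_wins[OF k])
      (auto intro!: sum_mono2 weight_nonneg[of "{..k}"], auto simp: configs_def PiE_dflt_def)
  finally show ?thesis .
qed

section \<open>Undecided parents\<close>

lemma balanced_parent_state:
  assumes k: "k \<ge> 2" and c: "c \<in> configs n {0, 1, 2}" and v: "votes n c 1 = votes n c 2"
  shows "parent_state n k c = 0"
proof (rule parent_state_eq_0[OF k])
  fix i assume i: "i \<in> {1..k}"
  show "\<exists>j\<in>{1..k} - {i}. votes n c i \<le> votes n c j"
  proof (cases "i = 1 \<or> i = 2")
    case True
    then show ?thesis using v k i by (intro bexI[of _ "3 - i"]) auto
  next
    case False
    then have "votes n c i = 0" using c i by (intro votes_eq_0) (auto dest: configsD)
    then show ?thesis using False k by (intro bexI[of _ 1]) auto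
  qed
qed

lemma parent_state_unbalanced:
  assumes k: "k \<ge> 2" and c: "c \<in> configs n {0, 1, 2}" and v: "votes n c 1 \<noteq> votes n c 2"
  shows "parent_state n k c \<noteq> 0"
proof -
  define i :: nat where "i = (if votes n c 1 > votes n c 2 then 1 else 2)"
  have "votes n c l = 0" if "l \<notin> {0, 1, 2}" for l
    using that c by (intro votes_eq_0) (auto dest: configsD)
  then have "votes n c l < votes n c i" if "l \<noteq> 0" "l \<noteq> i" for l
    using that v by (cases "l = 1"; cases "l = 2") (auto simp: i_def split: if_splits)
  then have "wins n k c i" using k by (auto simp: wins_def i_def)
  moreover have "i \<noteq> 0" by (simp add: i_def)
  ultimately show ?thesis using parent_state_eq_iff[OF k] by metis
qed

lemma vote_law_0_ge:
  assumes k: "k \<ge> 2" and q: "\<And>l. l \<le> k \<Longrightarrow> 0 \<le> q l" "q 1 = b" "q 2 = b"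
  shows "tie_poly n (q 0) b \<le> vote_law n k q 0"
proof -
  have "{0, 1, 2} \<subseteq> {..k}" using k by auto
  from configs_mono[OF this] show ?thesis
    unfolding sum_weight_balanced[OF q(2,3), symmetric] vote_law_def
    using balanced_parent_state[OF k] q by (intro sum_mono2 weight_nonneg[of "{..k}"]) auto
qed

lemma sum_UN_le:
  fixes w :: "'a \<Rightarrow> real"
  assumes "finite I" "\<And>x. x \<in> I \<Longrightarrow> finite (A x)" "\<And>x c. x \<in> I \<Longrightarrow> c \<in> A x \<Longrightarrow> 0 \<le> w c"
  shows "(\<Sum>c\<in>(\<Union>x\<in>I. A x). w c) \<le> (\<Sum>x\<in>I. \<Sum>c\<in>A x. w c)"
  using assms
proof (induction I rule: finite_induct)
  case (insert x I)
  have "(\<Sum>c\<in>A x \<union> (\<Union>y\<in>I. A y). w c) \<le> (\<Sum>c\<in>A x. w c) + (\<Sum>c\<in>(\<Union>y\<in>I. A y). w c)"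
    using insert by (subst sum_Un) (auto intro!: sum_nonneg)
  with insert show ?case by force
qed simp

text \<open>Union bound: if no child holds an opinion from 3 on, an undecided parent has as many
  votes for 1 as for 2; and each child holds such an opinion with probability
  \<open>(\<Sum>l=3..k. q l)\<close>.\<close>

lemma vote_law_0_le:
  assumes k: "k \<ge> 2" and q: "\<And>l. l \<le> k \<Longrightarrow> 0 \<le> q l" "q 1 = b" "q 2 = b" and sum1: "(\<Sum>l\<le>k. q l) = 1"
  shows "vote_law n k q 0 \<le> tie_poly n (q 0) b + n * (\<Sum>l=3..k. q l)"
proof -
  let ?B = "{c. c \<in> configs n {0, 1, 2} \<and> votes n c 1 = votes n c 2}"
  let ?O = "\<lambda>x. {c \<in> configs n {..k}. c x \<in> {3..k}}"
  have O: "(\<Sum>c\<in>?O x. weight n q c) = (\<Sum>l=3..k. q l)" if x: "x < n" for x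
  proof -
    have "?O x = PiE_dflt {..<n} 0 (\<lambda>y. if y = x then {3..k} else {..k})"
      using x by (auto simp: configs_def PiE_dflt_def)
    then have "(\<Sum>c\<in>?O x. weight n q c) = (\<Prod>y<n. \<Sum>l\<in>(if y = x then {3..k} else {..k}). q l)"
      unfolding weight_def by (subst sum_PiE_dflt_prod[symmetric, where f = "\<lambda>_. q"]) auto
    also have "\<dots> = (\<Prod>y<n. if y = x then (\<Sum>l=3..k. q l) else 1)"
      using sum1 by (intro prod.cong) auto
    finally show ?thesis using x by simp
  qed
  have sub: "{c. c \<in> configs n {..k} \<and> parent_state n k c = 0} \<subseteq> ?B \<union> (\<Union>x<n. ?O x)"
  proof
    fix c assume c: "c \<in> {c. c \<in> configs n {..k} \<and> parent_state n k c = 0}"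
    show "c \<in> ?B \<union> (\<Union>x<n. ?O x)"
    proof (cases "\<exists>x<n. c x \<ge> 3")
      case True
      then show ?thesis using c by (auto dest: configsD)
    next
      case False
      then have "c x \<in> {0, 1, 2}" if "x < n" for x using that by force
      then have "c \<in> configs n {0, 1, 2}" using c by (auto simp: configs_def PiE_dflt_def)
      then show ?thesis using c parent_state_unbalanced[OF k, of c n] by blast
    qed
  qed
  have "{0, 1, 2} \<subseteq> {..k}" using k by auto
  note B_sub = configs_mono[OF this, of n]
  have nn: "0 \<le> weight n q c" if "c \<in> configs n {..k}" for c
    using that q(1) by (intro weight_nonneg[of "{..k}"]) auto
  have "vote_law n k q 0 \<le> (\<Sum>c\<in>?B \<union> (\<Union>x<n. ?O x). weight n q c)"
    unfolding vote_law_def using sub B_sub nn by (intro sum_mono2) auto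
  also have "\<dots> \<le> (\<Sum>c\<in>?B. weight n q c) + (\<Sum>c\<in>(\<Union>x<n. ?O x). weight n q c)"
    using B_sub nn by (subst sum_Un) (auto intro!: sum_nonneg)
  also have "(\<Sum>c\<in>(\<Union>x<n. ?O x). weight n q c) \<le> (\<Sum>x<n. \<Sum>c\<in>?O x. weight n q c)"
    using nn by (intro sum_UN_le) auto
  also have "\<dots> = n * (\<Sum>l=3..k. q l)"
    by (subst sum.cong[OF refl O]) auto
  also have "(\<Sum>c\<in>?B. weight n q c) = tie_poly n (q 0) b"
    by (rule sum_weight_balanced[OF q(2,3)])
  finally show ?thesis by simp
qed

text \<open>This creates undecided mass when there is none. With n = 2h + 1, h votes for each leader
  and one for j are a tie, which is threefold if h = 1.\<close>

lemma vote_law_0_pos_odd: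
  assumes k: "k \<ge> 2" and n: "odd n" "n \<ge> 2" and q: "\<And>l. l \<le> k \<Longrightarrow> 0 \<le> q l"
    and j: "j \<in> {3..k}" and pos: "q 1 > 0" "q 2 > 0" "q j > 0"
  shows "vote_law n k q 0 > 0"
proof -
  from n obtain h where h: "n = 2 * h + 1" "h > 0" by (auto elim!: oddE)
  define c where "c x = (if x < h then 1 else if x < 2 * h then 2 else if x = 2 * h then j else 0)" for x
  have v1: "votes n c 1 = h"
  proof -
    have "{x. x < n \<and> c x = 1} = {..<h}" using j h by (auto simp: c_def)
    then show ?thesis by (simp add: votes_def)
  qed
  have v2: "votes n c 2 = h"
  proof -
    have "{x. x < n \<and> c x = 2} = {h..<2 * h}" using j h by (auto simp: c_def)
    then show ?thesis by (simp add: votes_def)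
  qed
  have v3: "votes n c i \<le> 1" if "i \<ge> 3" for i
  proof -
    have "{x. x < n \<and> c x = i} \<subseteq> {2 * h}" using that by (auto simp: c_def split: if_splits)
    from card_mono[OF _ this] show ?thesis by (simp add: votes_def)
  qed
  have "parent_state n k c = 0"
  proof (rule parent_state_eq_0[OF k])
    fix i assume i: "i \<in> {1..k}"
    consider "i = 1" | "i = 2" | "i \<ge> 3" using i by fastforce
    then show "\<exists>l\<in>{1..k} - {i}. votes n c i \<le> votes n c l"
    proof cases
      case 1 then show ?thesis using v1 v2 k by (intro bexI[of _ 2]) auto
    next
      case 2 then show ?thesis using v1 v2 k by (intro bexI[of _ 1]) auto
    next
      case 3 then show ?thesis using v1 v3[of i] k h by (intro bexI[of _ 1]) auto
    qed
  qed
  moreover have "c \<in> configs n {..k}" using k j h by (auto simp: configs_def PiE_dflt_def c_def)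
  ultimately have "weight n q c \<le> vote_law n k q 0" using q by (intro weight_le_vote_law) auto
  moreover have "weight n q c > 0"
    unfolding weight_def using pos h by (intro prod_pos) (auto simp: c_def)
  ultimately show ?thesis by linarith
qed

section \<open>Convergence\<close>

text \<open>For every node both bases lie in [-1, 1], where x^n is n-Lipschitz.\<close>

lemma tie_poly_lipschitz:
  assumes "0 \<le> a" "0 \<le> b" "a + 2 * b \<le> 1" "0 \<le> b'" "a + 2 * b' \<le> 1"
  shows "\<bar>tie_poly n a b - tie_poly n a b'\<bar> \<le> 2 * real n * \<bar>b - b'\<bar>"
proof -
  let ?x = "\<lambda>l. cos (2 * pi * real l / real (n + 1))"
  have bound: "\<bar>a + 2 * d * ?x l\<bar> \<le> 1" if "0 \<le> d" "a + 2 * d \<le> 1" for d l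
  proof -
    have "\<bar>2 * d * ?x l\<bar> \<le> 2 * d" using that by (simp add: abs_mult mult_left_le)
    then show ?thesis using that assms(1) by linarith
  qed
  have "\<bar>(a + 2 * b * ?x l) ^ n - (a + 2 * b' * ?x l) ^ n\<bar> \<le> 2 * real n * \<bar>b - b'\<bar>" for l
  proof -
    have "norm ((a + 2 * b * ?x l) ^ n - (a + 2 * b' * ?x l) ^ n)
        \<le> n * norm ((a + 2 * b * ?x l) - (a + 2 * b' * ?x l))"
      using bound assms by (intro norm_power_diff) auto
    also have "(a + 2 * b * ?x l) - (a + 2 * b' * ?x l) = 2 * (b - b') * ?x l"
      by (simp add: algebra_simps)
    also have "norm (2 * (b - b') * ?x l) \<le> 2 * \<bar>b - b'\<bar>"
      using mult_left_le[of "\<bar>?x l\<bar>" "2 * \<bar>b - b'\<bar>"] unfolding real_norm_def abs_mult by simp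
    finally show ?thesis by (simp add: mult_left_mono)
  qed
  then have "(\<Sum>l<n + 1. \<bar>(a + 2 * b * ?x l) ^ n - (a + 2 * b' * ?x l) ^ n\<bar>) \<le> (\<Sum>l<n + 1. 2 * real n * \<bar>b - b'\<bar>)"
    by (rule sum_mono)
  then have "\<bar>\<Sum>l<n + 1. (a + 2 * b * ?x l) ^ n - (a + 2 * b' * ?x l) ^ n\<bar> \<le> (n + 1) * (2 * real n * \<bar>b - b'\<bar>)"
    using sum_abs[of "\<lambda>l. (a + 2 * b * ?x l) ^ n - (a + 2 * b' * ?x l) ^ n" "{..<n + 1}"]
    by simp
  then show ?thesis
    by (subst (1 2) tie_poly_cos_average[of n "n + 1"])
       (simp_all add: sum_subtractf diff_divide_distrib[symmetric] divide_le_eq mult.commute)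
qed

text \<open>Covers both regimes of the theorem, leaders below 1/2 and leaders equal to 1/2; they are
  told apart only for odd n, by an extra assumption there.\<close>

locale two_leading_opinions =
  fixes n k :: nat and p :: "nat \<Rightarrow> real"
  assumes n: "n \<ge> 2" and k: "k \<ge> 2" and p: "p \<in> opinion_simplex k"
    and leaders: "p 1 = p 2" and others: "\<And>i. i \<in> {3..k} \<Longrightarrow> p i < p 1"
begin

abbreviation "P \<equiv> root_law n k p"

lemma P_0: "i \<le> k \<Longrightarrow> P 0 i = p i"
  by (simp add: root_law_0[OF p])

lemma P_Suc: "P (Suc m) i = vote_law n k (P m) i"
  by (rule root_law_Suc) (rule root_law_gt_k[OF k p])

lemma P_nonneg: "0 \<le> P m i"
  by (simp add: root_law_def)

lemma P_le_1: "P m i \<le> 1"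
  by (simp add: root_law_def pmf_le_1)

lemma sum_P: "(\<Sum>i\<le>k. P m i) = 1"
proof (induction m)
  case 0
  then show ?case using p by (simp add: P_0 opinion_simplex_def)
next
  case (Suc m)
  then show ?case using sum_vote_law[OF k, of n "P m"] by (simp add: P_Suc)
qed

lemma atMost_k: "{..k} = insert 0 {1..k}" "{1..k} = insert 1 (insert 2 {3..k})"
  using k by auto

lemma P_leaders: "P m 1 = P m 2"
proof (induction m)
  case 0
  then show ?case using k leaders by (simp add: P_0)
next
  case (Suc m)
  then show ?case unfolding P_Suc using k by (intro vote_law_eq) auto
qed

lemma decided: "(\<Sum>i=1..k. P m i) = 1 - P m 0"
  using sum_P[of m] unfolding atMost_k(1) by simp

lemma leader_eq: "2 * P m 1 = 1 - P m 0 - (\<Sum>i=3..k. P m i)"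
  using decided[of m] P_leaders[of m] unfolding atMost_k(2) by simp

lemma p_leader_pos: "p 1 > 0"
proof (rule ccontr)
  assume neg: "\<not> p 1 > 0"
  have nn: "p i \<ge> 0" if "i \<le> k" for i using p that by (auto simp: opinion_simplex_def)
  have "p 1 = 0" using neg nn[of 1] k by simp
  moreover have "p i = 0" if "i \<in> {3..k}" for i
    using others[OF that] nn[of i] that neg by auto
  ultimately have "(\<Sum>i=3..k. p i) = 0" "p 1 = 0" "p 2 = 0" using leaders by auto
  moreover have "(\<Sum>i\<le>k. p i) = p 0 + (p 1 + (p 2 + (\<Sum>i=3..k. p i)))"
    unfolding atMost_k by simp
  ultimately show False using p by (auto simp: opinion_simplex_def)
qed

lemma leader_pos: "P m 1 > 0"
proof (induction m)
  case 0
  then show ?case using k p_leader_pos by (simp add: P_0)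
next
  case (Suc m)
  have "P m 1 ^ n \<le> P (Suc m) 1"
    unfolding P_Suc using n k P_nonneg by (intro vote_law_unanimous) auto
  with Suc show ?case by (meson less_le_trans zero_less_power)
qed

text \<open>The gain in \<open>vote_law_ratio\<close> is used here only as nonnegative: the initial
  ratio, which is below 1, stays a bound. The quantitative decay must wait for the lower bound on
  the decided mass, which itself relies on the leaders staying ahead.\<close>

lemma ratio_bound:
  assumes i: "i \<in> {3..k}"
  shows "P m i \<le> p i / p 1 * P m 1"
proof (induction m)
  case 0
  then show ?case using i k p_leader_pos by (simp add: P_0)
next
  case (Suc m)
  have r: "p i / p 1 \<le> 1" using others[OF i] p_leader_pos by simp
  have le: "P m i \<le> P m 1"
    using Suc mult_right_mono[OF r P_nonneg[of m 1]] by simp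
  have "P m i * P m 1 ^ n - P m 1 * P m i ^ n = P m i * P m 1 * (P m 1 ^ (n - 1) - P m i ^ (n - 1))"
    using n by (cases n) (auto simp: algebra_simps)
  also have "\<dots> \<ge> 0"
    using le P_nonneg by (intro mult_nonneg_nonneg) (auto intro: power_mono)
  finally have "P m 1 * P (Suc m) i \<le> P m i * P (Suc m) 1"
    using vote_law_ratio[OF k, of n i 1 "P m"] n i k le P_nonneg by (simp add: P_Suc)
  also have "\<dots> \<le> p i / p 1 * P m 1 * P (Suc m) 1"
    using Suc P_nonneg by (rule mult_right_mono)
  finally have "P m 1 * P (Suc m) i \<le> P m 1 * (p i / p 1 * P (Suc m) 1)"
    by (simp add: mult_ac)
  then show ?case using leader_pos[of m] by (rule mult_left_le_imp_le)
qed

lemma le_leader: "i \<in> {1..k} \<Longrightarrow> P m i \<le> P m 1"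
proof -
  assume i: "i \<in> {1..k}"
  consider "i = 1" | "i = 2" | "i \<in> {3..k}" using i by fastforce
  then show ?thesis
  proof cases
    case 3
    then have "p i / p 1 \<le> 1" using others[of i] p_leader_pos by simp
    then show ?thesis using ratio_bound[OF 3, of m] mult_right_mono[of "p i / p 1" 1, OF _ P_nonneg[of m 1]] by simp
  qed (use P_leaders in auto)
qed

lemma decided_le: "1 - P m 0 \<le> k * P m 1"
  using sum_bounded_above[of "{1..k}" "P m" "P m 1"] le_leader[of _ m] decided[of m] by simp

text \<open>When almost nobody has decided, a parent decides with probability about n times that of a child;
  otherwise unanimity for the leaders gives a lower bound.\<close>

lemma decided_bounded_below: "\<exists>\<delta>>0. \<forall>m. \<delta> \<le> 1 - P m 0"
proof -
  have "((\<lambda>t::real. n * t ^ (n - 1)) \<longlongrightarrow> real n * 1 ^ (n - 1)) (at_left 1)"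
    by (intro tendsto_intros)
  then have "\<forall>\<^sub>F t::real in at_left 1. 1 < n * t ^ (n - 1)"
    using n by (intro order_tendstoD) auto
  then obtain t0 :: real where t0: "0 < t0" "t0 < 1" "1 < n * t0 ^ (n - 1)"
    by (rule at_left_1_obtain[OF _ zero_less_one])
  \<comment> \<open>The first entry is the initial decided mass. The second is for a step from P m 0
    < t0: a leader then has mass at least (1 - t0)/k, and unanimity for it gives the n-th
    power.\<close>
  define \<delta> where "\<delta> = min (1 - p 0) (((1 - t0) / k) ^ n)"
  have "\<delta> > 0" using p t0 k by (auto simp: \<delta>_def opinion_simplex_def)
  moreover have "\<delta> \<le> 1 - P m 0" for m
  proof (induction m)
    case 0
    then show ?case by (simp add: P_0 \<delta>_def)
  next
    case (Suc m)
    show ?case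
    proof (cases "t0 \<le> P m 0")
      case True
      have "1 \<le> n * P m 0 ^ (n - 1)"
        using t0 power_mono[OF True, of "n - 1"] mult_left_mono[of "t0 ^ (n - 1)" "P m 0 ^ (n - 1)" n] by simp
      then have "1 * (1 - P m 0) \<le> n * P m 0 ^ (n - 1) * (1 - P m 0)"
        using P_le_1 by (intro mult_right_mono) auto
      with Suc have "\<delta> \<le> n * P m 0 ^ (n - 1) * (1 - P m 0)"
        unfolding mult_1 by (rule order_trans)
      also have "\<dots> = (\<Sum>i=1..k. n * P m 0 ^ (n - 1) * P m i)"
        by (simp only: decided[symmetric] sum_distrib_left)
      also have "\<dots> \<le> (\<Sum>i=1..k. P (Suc m) i)"
        unfolding P_Suc using k P_nonneg by (intro sum_mono vote_law_one_decided) auto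
      finally show ?thesis by (simp only: decided)
    next
      case False
      then have "1 - t0 \<le> k * P m 1" using decided_le[of m] by simp
      then have "(1 - t0) / k \<le> P m 1" using k by (simp add: field_simps)
      then have "((1 - t0) / k) ^ n \<le> P m 1 ^ n" using t0 by (intro power_mono) auto
      also have "\<dots> \<le> P (Suc m) 1"
        unfolding P_Suc using n k P_nonneg by (intro vote_law_unanimous) auto
      also have "\<dots> \<le> (\<Sum>i=1..k. P (Suc m) i)"
        using k P_nonneg by (intro member_le_sum) auto
      finally show ?thesis unfolding decided by (simp add: \<delta>_def)
    qed
  qed
  ultimately show ?thesis by blast
qed

lemma others_tendsto_0:
  assumes i: "i \<in> {3..k}"
  shows "(\<lambda>m. P m i) \<longlonglongrightarrow> 0"
proof -
  obtain \<delta> where \<delta>: "\<delta> > 0" "\<And>m. \<delta> \<le> 1 - P m 0"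
    using decided_bounded_below by blast
  define c where "c = (\<delta> / k) ^ n"
  define r where "r = p i / p 1"
  \<comment> \<open>The factor by which the ratio x to the leader shrinks: the unanimous gain is at
    least x (1 - r) c times the new leader mass, because x^n <= x r and that mass is at most
    1.\<close>
  define \<mu> where "\<mu> = 1 - (1 - r) * c"
  have r: "0 \<le> r" "r < 1"
    using p p_leader_pos others[OF i] i by (auto simp: r_def opinion_simplex_def)
  have leader_ge: "\<delta> / k \<le> P m 1" for m
    using \<delta>(2)[of m] decided_le[of m] k by (simp add: field_simps)
  have c: "0 < c" "c \<le> 1" "\<And>m. c \<le> P m 1 ^ n"
  proof -
    show "0 < c" using \<delta> k by (simp add: c_def)
    show *: "c \<le> P m 1 ^ n" for m unfolding c_def using leader_ge \<delta> k by (intro power_mono) auto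
    show "c \<le> 1" using *[of 0] power_le_one[OF P_nonneg P_le_1, of 0 1 n] by simp
  qed
  have \<mu>: "0 \<le> \<mu>" "\<mu> < 1"
    using r c mult_le_one[of "1 - r" c] by (auto simp: \<mu>_def)
  have "P m i \<le> \<mu> ^ m * P m 1" for m
  proof (induction m)
    case 0
    then show ?case using le_leader i by simp
  next
    case (Suc m)
    let ?q = "P m" and ?H = "P (Suc m)"
    define x where "x = ?q i / ?q 1"
    have q1: "?q 1 > 0" by (rule leader_pos)
    have qi: "?q i = x * ?q 1" using q1 by (simp add: x_def)
    have x: "0 \<le> x" "x \<le> r" "x \<le> \<mu> ^ m"
      using P_nonneg q1 ratio_bound[OF i, of m] Suc by (auto simp: x_def r_def field_simps)
    have "x ^ n \<le> x ^ 2" using x r n by (intro power_decreasing) auto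
    also have "\<dots> \<le> x * r" using x by (simp add: power2_eq_square mult_left_mono)
    finally have xn: "x * (1 - r) \<le> x - x ^ n" by (simp add: algebra_simps)
    have "c * ?H 1 \<le> ?q 1 ^ n"
      using c(3)[of m] c(1) mult_left_mono[OF P_le_1[of "Suc m" 1], of c] by linarith
    then have "x * (1 - r) * (c * ?H 1) \<le> x * (1 - r) * ?q 1 ^ n"
      using x r by (intro mult_left_mono) auto
    also have "\<dots> \<le> (x - x ^ n) * ?q 1 ^ n"
      using xn q1 by (intro mult_right_mono) auto
    finally have gain: "x * (1 - r) * (c * ?H 1) \<le> (x - x ^ n) * ?q 1 ^ n" .
    have "?q 1 * ?H i + (?q i * ?q 1 ^ n - ?q 1 * ?q i ^ n) \<le> ?q i * ?H 1"
      unfolding P_Suc using n k i P_nonneg le_leader[of i m] by (intro vote_law_ratio) auto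
    then have "?q 1 * (?H i + (x - x ^ n) * ?q 1 ^ n) \<le> ?q 1 * (x * ?H 1)"
      unfolding qi by (simp add: algebra_simps power_mult_distrib)
    then have "?H i + (x - x ^ n) * ?q 1 ^ n \<le> x * ?H 1"
      using q1 by simp
    with gain have "?H i \<le> x * (\<mu> * ?H 1)"
      by (simp add: \<mu>_def algebra_simps)
    also have "\<dots> \<le> \<mu> ^ m * (\<mu> * ?H 1)"
      using x \<mu> P_nonneg by (intro mult_right_mono mult_nonneg_nonneg) auto
    finally show ?case by (simp add: mult_ac)
  qed
  then have upper: "P m i \<le> \<mu> ^ m" for m
    using mult_left_mono[OF P_le_1[of m 1], of "\<mu> ^ m"] \<mu> by (metis mult.right_neutral order_trans zero_le_power)
  have "(\<lambda>m. \<mu> ^ m) \<longlonglongrightarrow> 0" using \<mu> by (intro LIMSEQ_power_zero) auto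
  then show ?thesis
    using upper P_nonneg by (intro tendsto_sandwich[of "\<lambda>_. 0" "\<lambda>m. P m i" _ "\<lambda>m. \<mu> ^ m"]) auto
qed

section \<open>The undecided coordinate as a perturbed iteration\<close>

lemma sum_others_tendsto_0: "(\<lambda>m. \<Sum>i=3..k. P m i) \<longlonglongrightarrow> 0"
  using tendsto_sum[of "{3..k}" "\<lambda>i m. P m i" "\<lambda>_. 0"] others_tendsto_0 by simp

text \<open>One n comes from the union bound over children with a minor opinion. The other comes
  from replacing P m 1 by (1 - P m 0)/2, a shift by half the minor mass under a 2n-Lipschitz
  function.\<close>

lemma undecided_step: "\<bar>P (Suc m) 0 - tie_fun n (P m 0)\<bar> \<le> 2 * real n * (\<Sum>i=3..k. P m i)"
proof -
  let ?E = "\<Sum>i=3..k. P m i"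
  have E: "0 \<le> ?E" using P_nonneg by (intro sum_nonneg) auto
  have b: "P m 1 - (1 - P m 0) / 2 = - (?E / 2)" using leader_eq[of m] by (simp add: field_simps)
  have "\<bar>tie_poly n (P m 0) (P m 1) - tie_poly n (P m 0) ((1 - P m 0) / 2)\<bar> \<le> 2 * real n * \<bar>P m 1 - (1 - P m 0) / 2\<bar>"
    using P_nonneg P_le_1[of m 0] leader_eq[of m] E by (intro tie_poly_lipschitz) (auto simp: field_simps)
  also have "\<dots> = n * ?E" using b E by simp
  finally have "\<bar>tie_poly n (P m 0) (P m 1) - tie_fun n (P m 0)\<bar> \<le> n * ?E"
    by (simp add: tie_fun_eq_tie_poly)
  moreover have "tie_poly n (P m 0) (P m 1) \<le> P (Suc m) 0"
    unfolding P_Suc using k P_nonneg P_leaders[of m] by (intro vote_law_0_ge) auto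
  moreover have "P (Suc m) 0 \<le> tie_poly n (P m 0) (P m 1) + n * ?E"
    unfolding P_Suc using k P_nonneg P_leaders[of m] sum_P by (intro vote_law_0_le) auto
  moreover have "0 \<le> n * ?E" using E by simp
  ultimately show ?thesis by linarith
qed

lemma undecided_error_tendsto_0: "(\<lambda>m. P (Suc m) 0 - tie_fun n (P m 0)) \<longlonglongrightarrow> 0"
proof (rule Lim_null_comparison)
  show "\<forall>\<^sub>F m in sequentially. norm (P (Suc m) 0 - tie_fun n (P m 0)) \<le> 2 * real n * (\<Sum>i=3..k. P m i)"
    using undecided_step by simp
  show "(\<lambda>m. 2 * real n * (\<Sum>i=3..k. P m i)) \<longlonglongrightarrow> 0"
    using tendsto_mult_left[OF sum_others_tendsto_0, of "2 * real n"] by simp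
qed

lemma tendsto_if_undecided:
  assumes "(\<lambda>m. P m 0) \<longlonglongrightarrow> a" "i \<le> k"
  shows "(\<lambda>m. P m i) \<longlonglongrightarrow> two_opinion_vec a i"
proof -
  have "(\<lambda>m. (1 - P m 0 - (\<Sum>i=3..k. P m i)) / 2) \<longlonglongrightarrow> (1 - a - 0) / 2"
    using assms(1) sum_others_tendsto_0 by (intro tendsto_intros) auto
  moreover have "P m 1 = (1 - P m 0 - (\<Sum>i=3..k. P m i)) / 2" for m
    using leader_eq[of m] by (simp add: field_simps)
  ultimately have 1: "(\<lambda>m. P m 1) \<longlonglongrightarrow> (1 - a) / 2" by (simp only: diff_zero)
  then have 2: "(\<lambda>m. P m 2) \<longlonglongrightarrow> (1 - a) / 2" by (simp only: P_leaders)
  consider "i = 0" | "i = 1" | "i = 2" | "i \<in> {3..k}" using assms(2) by fastforce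
  then show ?thesis
    using 1 2 assms(1) others_tendsto_0 by cases (auto simp: two_opinion_vec_def)
qed

lemma undecided_tendsto_even:
  assumes even: "even n"
  shows "(\<lambda>m. P m 0) \<longlonglongrightarrow> tie_fixpoint n"
proof -
  obtain \<delta> where \<delta>: "\<delta> > 0" "\<And>m. \<delta> \<le> 1 - P m 0"
    using decided_bounded_below by blast
  obtain c where c: "0 < c" "c < tie_fun n 0 / 2"
    "\<And>t. c \<le> t \<Longrightarrow> t < 1 \<Longrightarrow> t \<noteq> tie_fixpoint n \<Longrightarrow> \<bar>tie_fun n t - tie_fixpoint n\<bar> < \<bar>t - tie_fixpoint n\<bar>"
    using tie_fun_contracts_even[OF n even] by metis
  \<comment> \<open>The margin between c and f(0)/2, the lower bound of f, absorbs the
    error.\<close>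
  have "\<forall>\<^sub>F m in sequentially. P (Suc m) 0 - tie_fun n (P m 0) > - (tie_fun n 0 / 2 - c)"
    using undecided_error_tendsto_0 c by (intro order_tendstoD) auto
  then have "\<forall>\<^sub>F m in sequentially. c \<le> P (Suc m) 0"
  proof eventually_elim
    case (elim m)
    then show ?case using tie_fun_even_ge[OF even P_nonneg P_le_1, of m 0] by linarith
  qed
  then have "\<forall>\<^sub>F m in sequentially. c \<le> P m 0"
    by (subst (asm) eventually_sequentially_Suc)
  then have ev: "\<forall>\<^sub>F m in sequentially. c \<le> P m 0 \<and> P m 0 \<le> 1 - \<delta>"
    by eventually_elim (use \<delta>(2) in \<open>auto simp: algebra_simps\<close>)
  show ?thesis
    by (rule perturbed_contraction_tendsto[OF continuous_on_tie_fun _ _ ev undecided_error_tendsto_0])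
       (use c \<delta> tie_fixpoint[OF n] in auto)
qed

lemma undecided_odd_ge:
  assumes odd: "odd n"
  shows "n * real ((n - 1) choose ((n - 1) div 2)) * P m 1 ^ (n - 1) * P m 0 \<le> P (Suc m) 0"
proof -
  from odd obtain h where h: "n = 2 * h + 1" by (elim oddE)
  have "tie_poly n (P m 0) (P m 1) \<le> P (Suc m) 0"
    unfolding P_Suc using k P_nonneg P_leaders[of m] by (intro vote_law_0_ge) auto
  then show ?thesis
    using tie_poly_ge_term[OF P_nonneg[of m 0] P_nonneg[of m 1], of h n] by (simp add: h mult_ac)
qed

text \<open>Below 1/2, either p 0 is positive or some minor opinion has mass and produces ties after
  one step, whence \<open>Suc m\<close>. Positivity then persists through configurations with one
  undecided child and the others split evenly between the leaders.\<close>

lemma undecided_pos_odd: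
  assumes odd: "odd n" and half: "p 1 < 1 / 2"
  shows "P (Suc m) 0 > 0"
proof -
  have step: "P (Suc m) 0 > 0" if "P m 0 > 0" for m
  proof -
    have "0 < n * real ((n - 1) choose ((n - 1) div 2)) * P m 1 ^ (n - 1) * P m 0"
      using that leader_pos[of m] n by (auto simp: zero_less_binomial)
    then show ?thesis using undecided_odd_ge[OF odd, of m] by linarith
  qed
  show ?thesis
  proof (induction m)
    case 0
    show ?case
    proof (cases "P 0 0 > 0")
      case False
      then have "P 0 0 = 0" using P_nonneg[of 0 0] by simp
      then have "(\<Sum>i=3..k. P 0 i) > 0"
        using leader_eq[of 0] half k by (simp add: P_0)
      then obtain j where j: "j \<in> {3..k}" "P 0 j > 0"
        by (metis P_nonneg less_irrefl sum_nonpos not_less)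
      then show ?thesis
        unfolding P_Suc[of 0 0] using P_nonneg leader_pos[of 0] P_leaders[of 0]
        by (intro vote_law_0_pos_odd[OF k odd n, where j = j]) auto
    qed (rule step)
  qed (rule step)
qed

lemma undecided_tendsto_odd:
  assumes odd: "odd n" and half: "p 1 < 1 / 2"
  shows "(\<lambda>m. P m 0) \<longlonglongrightarrow> tie_fixpoint n"
proof -
  obtain \<delta> where \<delta>: "\<delta> > 0" "\<And>m. \<delta> \<le> 1 - P m 0"
    using decided_bounded_below by blast
  define B where "B = n * real ((n - 1) choose ((n - 1) div 2))"
  have B: "B > 2 ^ (n - 1)" unfolding B_def by (rule odd_central_gt[OF odd n])
  have "((\<lambda>t. B * ((1 - t) / 2) ^ (n - 1)) \<longlongrightarrow> B * ((1 - 0) / 2) ^ (n - 1)) (at_right 0)"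
    by (intro tendsto_intros) auto
  then have "\<forall>\<^sub>F t in at_right 0. 1 < B * ((1 - t) / 2) ^ (n - 1)"
    using B by (intro order_tendstoD) (auto simp: power_divide)
  \<comment> \<open>Half of \<open>t1\<close> is allotted to P m 0 and half to the minor mass; then
    P m 1 is at least (1 - t1)/2, so the undecided mass does not shrink in the next step.\<close>
  then obtain t1 where t1: "0 < t1" "t1 < 1" "1 < B * ((1 - t1) / 2) ^ (n - 1)"
    by (rule at_right_0_obtain[OF _ zero_less_one])
  \<comment> \<open>Bounds the next undecided mass when the present one exceeds t1/2, the leader
    having mass at least \<delta>/k.\<close>
  define d where "d = B * (\<delta> / k) ^ (n - 1) * (t1 / 2)"
  have Bpos: "B > 0" using B by (smt (verit) zero_less_power)
  have d: "d > 0" using Bpos \<delta> t1 k by (auto simp: d_def)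
  have leader_ge: "\<delta> / k \<le> P m 1" for m
    using \<delta>(2)[of m] decided_le[of m] k by (simp add: field_simps)
  have "\<forall>\<^sub>F m in sequentially. (\<Sum>i=3..k. P m i) < t1 / 2"
    using sum_others_tendsto_0 t1 by (intro order_tendstoD) auto
  then obtain M where M: "\<And>m. m \<ge> M \<Longrightarrow> (\<Sum>i=3..k. P m i) < t1 / 2"
    by (auto simp: eventually_sequentially)
  have step: "min (P m 0) d \<le> P (Suc m) 0" if "m \<ge> M" for m
  proof -
    have ge: "B * P m 1 ^ (n - 1) * P m 0 \<le> P (Suc m) 0"
      using undecided_odd_ge[OF odd, of m] by (simp add: B_def)
    show ?thesis
    proof (cases "P m 0 \<le> t1 / 2")
      case True
      then have "(1 - t1) / 2 \<le> P m 1"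
        using leader_eq[of m] M[OF that] by simp
      then have "B * ((1 - t1) / 2) ^ (n - 1) \<le> B * P m 1 ^ (n - 1)"
        using Bpos t1 by (intro mult_left_mono power_mono) auto
      then have "1 * P m 0 \<le> B * P m 1 ^ (n - 1) * P m 0"
        using t1 P_nonneg by (intro mult_right_mono) auto
      then show ?thesis using ge by simp
    next
      case False
      have "d \<le> B * P m 1 ^ (n - 1) * P m 0"
        unfolding d_def using False Bpos t1 \<delta> k leader_ge[of m] P_nonneg
        by (intro mult_mono mult_left_mono power_mono) auto
      then show ?thesis using ge by simp
    qed
  qed
  \<comment> \<open>The lower bound is propagated from \<open>Suc M\<close>, since the undecided
    mass may still be 0 at generation 0.\<close>
  define lo where "lo = min (P (Suc M) 0) d"
  have lo: "lo > 0" using d undecided_pos_odd[OF odd half, of M] by (simp add: lo_def)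
  have "lo \<le> P m 0" if "m \<ge> Suc M" for m
    using that
  proof (induction m rule: dec_induct)
    case (step m)
    then show ?case using \<open>\<And>m. m \<ge> M \<Longrightarrow> min (P m 0) d \<le> P (Suc m) 0\<close>[of m] by (simp add: lo_def)
  qed (simp add: lo_def)
  then have "\<forall>\<^sub>F m in sequentially. lo \<le> P m 0"
    by (auto simp: eventually_sequentially)
  then have ev: "\<forall>\<^sub>F m in sequentially. lo \<le> P m 0 \<and> P m 0 \<le> 1 - \<delta>"
    by eventually_elim (use \<delta>(2) in \<open>auto simp: algebra_simps\<close>)
  show ?thesis
    by (rule perturbed_contraction_tendsto[OF continuous_on_tie_fun _ _ ev undecided_error_tendsto_0])
       (use tie_fun_contracts_odd[OF n odd] lo \<delta> tie_fixpoint[OF n] in auto)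
qed

end

lemma opinion_simplex_half_others:
  assumes "p \<in> opinion_simplex k" "k \<ge> 2" "p 1 = 1 / 2" "p 2 = 1 / 2" "i \<le> k" "i \<noteq> 1" "i \<noteq> 2"
  shows "p i = 0"
proof -
  have nn: "p j \<ge> 0" if "j \<le> k" for j using assms(1) that by (auto simp: opinion_simplex_def)
  have "{..k} = insert 1 (insert 2 ({..k} - {1, 2}))" using assms(2) by auto
  then have "(\<Sum>j\<le>k. p j) = p 1 + (p 2 + (\<Sum>j\<in>{..k} - {1, 2}. p j))"
    by (metis (no_types, lifting) Diff_iff finite_Diff finite_atMost finite_insert insertCI insertE
        one_eq_numeral_iff semiring_norm(85) sum.insert)
  then have "(\<Sum>j\<in>{..k} - {1, 2}. p j) = 0"
    using assms by (simp add: opinion_simplex_def)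
  then show ?thesis
    using nn assms by (subst (asm) sum_nonneg_eq_0_iff) auto
qed

lemma two_leading_opinions_half:
  assumes "n \<ge> 2" "k \<ge> 2" "p \<in> opinion_simplex k" "p 1 = 1 / 2" "p 2 = 1 / 2"
  shows "two_leading_opinions n k p"
  using assms opinion_simplex_half_others[OF assms(3,2,4,5)] by unfold_locales auto

theorem theorem1p1:
  fixes n :: nat
  assumes "n \<ge> 2"
  shows "(\<forall>t\<in>{0..1}. tie_fun n t \<in> {0..1})
    \<and> (\<exists>!t. t \<in> {0<..<1} \<and> tie_fun n t = t)
    \<and> (\<forall>k\<ge>2. \<forall>p\<in>opinion_simplex k.
         (p 1 = p 2 \<and> (3 \<le> k \<longrightarrow> p 2 > p 3) \<and> (\<forall>i\<in>{3..<k}. p i \<ge> p (i + 1)) \<and> p 1 < 1 / 2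
          \<longrightarrow> (\<forall>i\<le>k. (\<lambda>m. root_law n k p m i) \<longlonglongrightarrow> two_opinion_vec (tie_fixpoint n) i))
       \<and> (p 1 = 1 / 2 \<and> p 2 = 1 / 2 \<and> even n
          \<longrightarrow> (\<forall>i\<le>k. (\<lambda>m. root_law n k p m i) \<longlonglongrightarrow> two_opinion_vec (tie_fixpoint n) i))
       \<and> (p 1 = 1 / 2 \<and> p 2 = 1 / 2 \<and> odd n
          \<longrightarrow> (\<forall>m. \<forall>i\<le>k. root_law n k p m i = two_opinion_vec 0 i)))"
proof (intro conjI ballI allI impI)
  show "tie_fun n t \<in> {0..1}" if "t \<in> {0..1}" for t
    using that tie_fun_nonneg[of t n] tie_fun_le_1[of t n] assms by auto
  show "\<exists>!t. t \<in> {0<..<1} \<and> tie_fun n t = t"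
    by (rule tie_fixpoint_ex1[OF assms])
next
  fix k p i
  assume k: "2 \<le> k" and p: "p \<in> opinion_simplex k" and i: "i \<le> k"
    and asm: "p 1 = p 2 \<and> (3 \<le> k \<longrightarrow> p 2 > p 3) \<and> (\<forall>i\<in>{3..<k}. p i \<ge> p (i + 1)) \<and> p 1 < 1 / 2"
  have le3: "p j \<le> p 3" if "3 \<le> j" "j \<le> k" for j
    using that
  proof (induction j rule: dec_induct)
    case (step j)
    have "p (j + 1) \<le> p j" using asm step by auto
    then show ?case using step by simp
  qed simp
  interpret two_leading_opinions n k p
    by unfold_locales (use assms k p asm le3 in force)+
  show "(\<lambda>m. root_law n k p m i) \<longlonglongrightarrow> two_opinion_vec (tie_fixpoint n) i"
    using undecided_tendsto_even undecided_tendsto_odd asm i by (intro tendsto_if_undecided) auto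
next
  fix k p i
  assume k: "2 \<le> k" and p: "p \<in> opinion_simplex k" and i: "i \<le> k"
    and asm: "p 1 = 1 / 2 \<and> p 2 = 1 / 2 \<and> even n"
  interpret two_leading_opinions n k p
    using assms k p asm by (intro two_leading_opinions_half) auto
  show "(\<lambda>m. root_law n k p m i) \<longlonglongrightarrow> two_opinion_vec (tie_fixpoint n) i"
    using undecided_tendsto_even asm i by (intro tendsto_if_undecided) auto
next
  fix k p m i
  assume k: "2 \<le> k" and p: "p \<in> opinion_simplex k" and i: "i \<le> k"
    and asm: "p 1 = 1 / 2 \<and> p 2 = 1 / 2 \<and> odd n"
  interpret two_leading_opinions n k p
    using assms k p asm by (intro two_leading_opinions_half) auto
  have zero: "p j = 0" if "j \<le> k" "j \<noteq> 1" "j \<noteq> 2" for j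
    using opinion_simplex_half_others[OF p k _ _ that] asm by simp
  \<comment> \<open>The initial ratio is 0, so the minor opinions never appear. The error in
    \<open>undecided_step\<close> is then 0, and 0 is fixed by the tie function because n is
    odd.\<close>
  have others0: "P m j = 0" if "j \<in> {3..k}" for m j
    using ratio_bound[OF that, of m] zero[of j] that P_nonneg[of m j] by simp
  have undecided0: "P m 0 = 0" for m
  proof (induction m)
    case 0
    then show ?case using zero[of 0] by (simp add: P_0)
  next
    case (Suc m)
    then show ?case using undecided_step[of m] others0 asm by (simp add: tie_fun_0_odd)
  qed
  have "P m 1 = 1 / 2" "P m 2 = 1 / 2"
    using leader_eq[of m] P_leaders[of m] others0 undecided0 by simp_all
  moreover consider "i = 0" | "i = 1" | "i = 2" | "i \<in> {3..k}" using i by fastforce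
  ultimately show "root_law n k p m i = two_opinion_vec 0 i"
    using others0 undecided0 by cases (auto simp: two_opinion_vec_def)
qed

end
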